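(* The elements $x_1,\dots,x_N\in S(\mathfrak{g}_e)$ defined below are algebraically independent generators of the invariant algebra $S(\mathfrak{g}_e)^{\mathfrak{g}_e}$ for the adjoint action of $\mathfrak{g}_e$ on its symmetric algebra.
   Context: $F$ is an algebraically closed field of characteristic zero; $\lambda=(\lambda_1,\dots,\lambda_n)$ is a composition of $N$ with positive parts and $\lambda_1\le\cdots\le\lambda_n$; $s_{i,j}:=\lambda_j-\min(\lambda_i,\lambda_j)$. $e\in\mathfrak{g}=\mathfrak{gl}_N(F)$ is the nilpotent matrix with Jordan blocks $\lambda_1,\dots,\lambda_n$ down the diagonal and $\mathfrak{g}_e$ its centralizer. With the diagram whose row $i$ has $\lambda_i$ boxes, filled with $1,\dots,N$ along rows, and $\mathrm{row}(h),\mathrm{col}(h)$ the row/column of $h$, set $e_{i,j;r}:=\sum_{\mathrm{row}(h)=i,\mathrm{row}(k)=j,\mathrm{col}(k)-\mathrm{col}(h)=r}e_{h,k}$ ($e_{h,k}$ matrix units) for $s_{i,j}\le r<\lambda_j$; these form a basis of $\mathfrak{g}_e$. $(d_1,\dots,d_N)$ consists of $\lambda_n$ copies of $1$, then $\lambda_{n-1}$ copies of $2$, ..., then $\lambda_1$ copies of $n$. For $\mu\subseteq\lambda$ ($0\le\mu_i\le\lambda_i$), $|\mu|=\sum\mu_i$, $\ell(\mu)$ = number of nonzero parts. For $r=1,\dots,N$, with $d=d_r$, $x_r:=\sum_{\mu\subseteq\lambda,\ |\mu|=r,\ \ell(\mu)=d}\sum_{w\in S_d}\mathrm{sgn}(w)\,e_{i_{w1},i_1;\mu_{i_1}-1}\cdots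 e_{i_{wd},i_d;\mu_{i_d}-1}\in S(\mathfrak{g}_e)$, where $i_1<\cdots<i_d$ are the positions of the nonzero entries of $\mu$. *)

theory Defs
  imports "HOL-Library.Poly_Mapping" "HOL-Computational_Algebra.Polynomial"
          "HOL-Combinatorics.Permutations"
begin

text \<open>Data: n rows, lam :: nat => nat giving the parts lam 1, ..., lam n (1-based).
  Matrices in gl_N are functions nat => nat => 'a, indices 1..N.\<close>

definition totN :: "nat \<Rightarrow> (nat \<Rightarrow> nat) \<Rightarrow> nat" where
  "totN n lam = (\<Sum>i\<in>{1..n}. lam i)"

text \<open>Number of the box in row i, column c, filling 1..N along rows.\<close>
definition boxnum :: "(nat \<Rightarrow> nat) \<Rightarrow> nat \<Rightarrow> nat \<Rightarrow> nat" where
  "boxnum lam i c = (\<Sum>k\<in>{1..<i}. lam k) + c"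

definition sij :: "(nat \<Rightarrow> nat) \<Rightarrow> nat \<Rightarrow> nat \<Rightarrow> nat" where
  "sij lam i j = lam j - min (lam i) (lam j)"

text \<open>e_{i,j;r} = sum of matrix units e_{h,k} with row h = i, row k = j, col k - col h = r.\<close>
definition emat :: "(nat \<Rightarrow> nat) \<Rightarrow> nat \<times> nat \<times> nat \<Rightarrow> nat \<Rightarrow> nat \<Rightarrow> 'a::field" where
  "emat lam b = (case b of (i, j, r) \<Rightarrow> (\<lambda>h k.
     if (\<exists>c. 1 \<le> c \<and> c \<le> lam i \<and> c + r \<le> lam j \<and>
              h = boxnum lam i c \<and> k = boxnum lam j (c + r)) then 1 else 0))"

text \<open>Index set of the basis of g_e.\<close>
definition gbasis :: "nat \<Rightarrow> (nat \<Rightarrow> nat) \<Rightarrow> (nat \<times> nat \<times> nat) set" where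
  "gbasis n lam = {(i, j, r). i \<in> {1..n} \<and> j \<in> {1..n} \<and> sij lam i j \<le> r \<and> r < lam j}"

definition matmul :: "nat \<Rightarrow> (nat \<Rightarrow> nat \<Rightarrow> 'a::field) \<Rightarrow> (nat \<Rightarrow> nat \<Rightarrow> 'a) \<Rightarrow> nat \<Rightarrow> nat \<Rightarrow> 'a" where
  "matmul N A B = (\<lambda>h k. \<Sum>l\<in>{1..N}. A h l * B l k)"

definition mbracket :: "nat \<Rightarrow> (nat \<Rightarrow> nat \<Rightarrow> 'a::field) \<Rightarrow> (nat \<Rightarrow> nat \<Rightarrow> 'a) \<Rightarrow> nat \<Rightarrow> nat \<Rightarrow> 'a" where
  "mbracket N A B = (\<lambda>h k. matmul N A B h k - matmul N B A h k)"

text \<open>Coefficient of e_{i,j;r} in an element X of g_e: the matrix units occurring in the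
  different basis elements are pairwise distinct, so it is the entry of X at the
  position (box (i,1), box (j,1+r)), which lies in the support of e_{i,j;r}.\<close>
definition coord :: "(nat \<Rightarrow> nat) \<Rightarrow> nat \<times> nat \<times> nat \<Rightarrow> (nat \<Rightarrow> nat \<Rightarrow> 'a) \<Rightarrow> 'a" where
  "coord lam b X = (case b of (i, j, r) \<Rightarrow> X (boxnum lam i 1) (boxnum lam j (1 + r)))"

text \<open>Polynomials in the basis variables: a model of S(g_e).\<close>
type_synonym 'a sym = "((nat \<times> nat \<times> nat) \<Rightarrow>\<^sub>0 nat) \<Rightarrow>\<^sub>0 'a"

definition PConst :: "'a::comm_ring_1 \<Rightarrow> 'a sym" where
  "PConst c = Poly_Mapping.single 0 c"

definition PVar :: "nat \<times> nat \<times> nat \<Rightarrow> 'a::comm_ring_1 sym" where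
  "PVar b = Poly_Mapping.single (Poly_Mapping.single b 1) 1"

definition pdv :: "nat \<times> nat \<times> nat \<Rightarrow> 'a::comm_ring_1 sym \<Rightarrow> 'a sym" where
  "pdv b p = (\<Sum>m\<in>Poly_Mapping.keys p.
      Poly_Mapping.single (m - Poly_Mapping.single b 1)
        (Poly_Mapping.lookup p m * of_nat (Poly_Mapping.lookup m b)))"

definition linS :: "nat \<Rightarrow> (nat \<Rightarrow> nat) \<Rightarrow> (nat \<Rightarrow> nat \<Rightarrow> 'a::field) \<Rightarrow> 'a sym" where
  "linS n lam X = (\<Sum>d\<in>gbasis n lam. PConst (coord lam d X) * PVar d)"

text \<open>Adjoint action of the basis element e_b on S(g_e): the derivation extending ad e_b.\<close>
definition adS :: "nat \<Rightarrow> (nat \<Rightarrow> nat) \<Rightarrow> nat \<times> nat \<times> nat \<Rightarrow> 'a::field sym \<Rightarrow> 'a sym" where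
  "adS n lam b p = (\<Sum>c\<in>gbasis n lam.
      pdv c p * linS n lam (mbracket (totN n lam) (emat lam b) (emat lam c)))"

definition Sge :: "nat \<Rightarrow> (nat \<Rightarrow> nat) \<Rightarrow> 'a::field sym set" where
  "Sge n lam = {p. \<forall>m\<in>Poly_Mapping.keys p. Poly_Mapping.keys m \<subseteq> gbasis n lam}"

text \<open>The invariant algebra S(g_e)^{g_e} (invariance under all of g_e is equivalent to
  invariance under a basis, the action being linear).\<close>
definition InvS :: "nat \<Rightarrow> (nat \<Rightarrow> nat) \<Rightarrow> 'a::field sym set" where
  "InvS n lam = {p \<in> Sge n lam. \<forall>b\<in>gbasis n lam. adS n lam b p = 0}"

definition evar :: "nat \<Rightarrow> (nat \<Rightarrow> nat) \<Rightarrow> nat \<times> nat \<times> nat \<Rightarrow> 'a::field sym" where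
  "evar n lam b = (if b \<in> gbasis n lam then PVar b else 0)"

text \<open>d_r: lam n copies of 1, then lam (n-1) copies of 2, ..., lam 1 copies of n.\<close>
definition dseq :: "nat \<Rightarrow> (nat \<Rightarrow> nat) \<Rightarrow> nat \<Rightarrow> nat" where
  "dseq n lam r = (LEAST d. r \<le> (\<Sum>k<d. lam (n - k)))"

definition subcomps :: "nat \<Rightarrow> (nat \<Rightarrow> nat) \<Rightarrow> (nat \<Rightarrow> nat) set" where
  "subcomps n lam = {mu. \<forall>i. mu i \<le> (if i \<in> {1..n} then lam i else 0)}"

definition xgen :: "nat \<Rightarrow> (nat \<Rightarrow> nat) \<Rightarrow> nat \<Rightarrow> 'a::field sym" where
  "xgen n lam r =
    (\<Sum>mu\<in>{mu \<in> subcomps n lam. (\<Sum>i\<in>{1..n}. mu i) = r \<and>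
                card {i\<in>{1..n}. mu i \<noteq> 0} = dseq n lam r}.
      \<Sum>\<sigma>\<in>{\<sigma>. \<sigma> permutes {i\<in>{1..n}. mu i \<noteq> 0}}.
        of_int (sign \<sigma>) * (\<Prod>i\<in>{i\<in>{1..n}. mu i \<noteq> 0}. evar n lam (\<sigma> i, i, mu i - 1)))"

definition peval :: "((nat \<Rightarrow>\<^sub>0 nat) \<Rightarrow>\<^sub>0 'a::comm_ring_1) \<Rightarrow> (nat \<Rightarrow> 'a sym) \<Rightarrow> 'a sym" where
  "peval Q x = (\<Sum>m\<in>Poly_Mapping.keys Q.
      PConst (Poly_Mapping.lookup Q m) * (\<Prod>k\<in>Poly_Mapping.keys m. x k ^ Poly_Mapping.lookup m k))"

end

theory Submission
  imports Defs "HOL-Library.FuncSet"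
begin

text \<open>Put \<open>E\<^sub>i\<^sub>j(u) = \<Sum>\<^sub>r e\<^sub>i\<^sub>j\<^sub>;\<^sub>r u\<^bsup>lam j - 1 - r\<^esup>\<close>. Then \<open>x\<^sub>r\<close> (with \<open>d = d\<^sub>r\<close>) is the coefficient of
  \<open>y\<^bsup>n - d\<^esup> u\<^bsup>N - r\<^esup>\<close> in the determinant of \<open>M = y diag(u\<^bsup>lam j\<^esup>) + E(u)\<close>. The adjoint action of
  \<open>e\<^sub>k\<^sub>l\<^sub>;\<^sub>s\<close> changes \<open>M\<close> by \<open>A M - M B\<close>, where \<open>A\<close> and \<open>B\<close> have the same trace, up to an error
  whose \<open>(i, j)\<close> entry is divisible by \<open>u\<^bsup>min (lam i) (lam j)\<^esup>\<close> because of the truncations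
  \<open>r \<ge> s\<^sub>i\<^sub>j\<close>; the error only reaches exponents of \<open>u\<close> above those of the \<open>x\<^sub>r\<close>. Hence the
  \<open>x\<^sub>r\<close> are invariant.

  Consider the affine slice in the dual of the centralizer on which \<open>e\<^sub>i\<^sub>,\<^sub>i\<^sub>+\<^sub>1\<close> with the top exponent
  equals 1, the other \<open>e\<^sub>i\<^sub>j\<^sub>;\<^sub>r\<close> with \<open>i < n\<close> vanish, and the \<open>e\<^sub>n\<^sub>j\<^sub>;\<^sub>r\<close> are free. There \<open>E(u)\<close> is a
  companion matrix, so each \<open>x\<^sub>r\<close> restricts to one of the \<open>N\<close> free coordinates, up to sign.
  At every point of the slice the directions of the adjoint action and of the slice span the whole
  space, so in characteristic zero an invariant that vanishes on the slice vanishes there to all orders,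
  and is zero. Restriction therefore identifies the invariants with the polynomial functions on
  the slice, that is, with the polynomials in the \<open>x\<^sub>r\<close>.\<close>

section \<open>Polynomials over a commutative ring\<close>

lemma poly_mapping_sum_single:
  fixes p :: "'v \<Rightarrow>\<^sub>0 'c::comm_monoid_add"
  shows "p = (\<Sum>m\<in>Poly_Mapping.keys p. Poly_Mapping.single m (Poly_Mapping.lookup p m))"
  by (rule poly_mapping_eqI)
     (auto simp: lookup_sum lookup_single when_def in_keys_iff sum.delta)

lemma poly_mapping_single_induct [case_names single sum]:
  fixes p :: "'v \<Rightarrow>\<^sub>0 'c::comm_monoid_add"
  assumes single: "\<And>k v. P (Poly_Mapping.single k v)"
    and sum: "\<And>p q. P p \<Longrightarrow> P q \<Longrightarrow> P (p + q)"
  shows "P p"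
proof -
  have 0: "P 0" using single[of undefined 0] by simp
  have "P (\<Sum>m\<in>A. Poly_Mapping.single m (Poly_Mapping.lookup p m))" for A
    by (induction A rule: infinite_finite_induct) (auto intro: single sum 0)
  then show ?thesis by (subst poly_mapping_sum_single)
qed

lemma mpoly_induct [case_names const var add mult]:
  fixes p :: "('v \<Rightarrow>\<^sub>0 nat) \<Rightarrow>\<^sub>0 'a::comm_ring_1"
  assumes const: "\<And>c. P (Poly_Mapping.single 0 c)"
    and var: "\<And>b. P (Poly_Mapping.single (Poly_Mapping.single b 1) 1)"
    and add: "\<And>p q. P p \<Longrightarrow> P q \<Longrightarrow> P (p + q)"
    and mult: "\<And>p q. P p \<Longrightarrow> P q \<Longrightarrow> P (p * q)"
  shows "P p"
proof -
  have mon_single: "P (Poly_Mapping.single (Poly_Mapping.single v k) 1)" for v k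
  proof (induction k)
    case 0
    then show ?case using const[of 1] by simp
  next
    case (Suc k)
    have "Poly_Mapping.single (Poly_Mapping.single v (Suc k)) (1::'a) =
      Poly_Mapping.single (Poly_Mapping.single v k) 1 * Poly_Mapping.single (Poly_Mapping.single v 1) 1"
      by (simp add: mult_single flip: single_add)
    then show ?case using mult[OF Suc var] by simp
  qed
  have mon: "P (Poly_Mapping.single m 1)" for m
  proof (induction m rule: poly_mapping_single_induct)
    case (single k v)
    then show ?case by (rule mon_single)
  next
    case (sum p q)
    have "Poly_Mapping.single (p + q) (1::'a) = Poly_Mapping.single p 1 * Poly_Mapping.single q 1"
      by (simp add: mult_single)
    then show ?case using mult sum by simp
  qed
  show ?thesis
  proof (induction p rule: poly_mapping_single_induct)
    case (single k v)
    have "Poly_Mapping.single k v = Poly_Mapping.single 0 v * Poly_Mapping.single k 1"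
      by (simp add: mult_single)
    then show ?case using mult[OF const mon] by simp
  next
    case (sum p q)
    then show ?case using add by simp
  qed
qed

text \<open>One notion of evaluation covers the substitution of generators (\<open>peval\<close>),
  the restriction to the slice (\<open>rho\<close>) and the map back to abstract variables
  (\<open>kap\<close>).\<close>

definition mev :: "('a::comm_ring_1 \<Rightarrow> 'b::comm_ring_1) \<Rightarrow> ('v \<Rightarrow> 'b) \<Rightarrow> (('v \<Rightarrow>\<^sub>0 nat) \<Rightarrow>\<^sub>0 'a) \<Rightarrow> 'b" where
  "mev h f p = (\<Sum>m\<in>Poly_Mapping.keys p. h (Poly_Mapping.lookup p m) *
      (\<Prod>k\<in>Poly_Mapping.keys m. f k ^ Poly_Mapping.lookup m k))"

lemma peval_mev: "peval Q x = mev PConst x Q"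
  by (simp add: peval_def mev_def)

definition ring_morph :: "('a::comm_ring_1 \<Rightarrow> 'b::comm_ring_1) \<Rightarrow> bool" where
  "ring_morph h \<longleftrightarrow> h 1 = 1 \<and> (\<forall>x y. h (x + y) = h x + h y) \<and> (\<forall>x y. h (x * y) = h x * h y)"

lemma ring_morphD:
  assumes "ring_morph h"
  shows ring_morph_1: "h 1 = 1" and ring_morph_0: "h 0 = 0"
    and ring_morph_add: "h (x + y) = h x + h y" and ring_morph_mult: "h (x * y) = h x * h y"
    and ring_morph_uminus: "h (- x) = - h x" and ring_morph_diff: "h (x - y) = h x - h y"
proof -
  show 1: "h 1 = 1" and a: "h (x + y) = h x + h y" and "h (x * y) = h x * h y" for x y
    using assms by (auto simp: ring_morph_def)
  show 0: "h 0 = 0" using a[of 0 0] by simp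
  show m: "h (- x) = - h x" for x using a[of x "- x"] 0 by (simp add: eq_neg_iff_add_eq_0 add.commute)
  show "h (x - y) = h x - h y" using a[of x "- y"] m[of y] by simp
qed

lemma ring_morph_sum: "ring_morph h \<Longrightarrow> h (sum f A) = (\<Sum>i\<in>A. h (f i))"
  by (induction A rule: infinite_finite_induct) (auto simp: ring_morphD)

lemma ring_morph_prod: "ring_morph h \<Longrightarrow> h (prod f A) = (\<Prod>i\<in>A. h (f i))"
  by (induction A rule: infinite_finite_induct) (auto simp: ring_morphD)

lemma ring_morph_of_int: "ring_morph h \<Longrightarrow> h (of_int k) = of_int k"
proof -
  assume h: "ring_morph h"
  have n: "h (of_nat j) = of_nat j" for j
    by (induction j) (auto simp: ring_morphD[OF h])
  show ?thesis
    by (cases k rule: int_diff_cases) (simp add: ring_morphD[OF h] n)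
qed

lemma ring_morph_single0: "ring_morph (Poly_Mapping.single (0 :: 'v::comm_monoid_add) :: 'a::comm_ring_1 \<Rightarrow> _)"
  by (auto simp: ring_morph_def single_add mult_single)

lemma PConst_morph: "ring_morph (PConst :: 'a::comm_ring_1 \<Rightarrow> _)"
  using ring_morph_single0 by (simp add: PConst_def[abs_def])

definition mmon :: "('v \<Rightarrow> 'b::comm_ring_1) \<Rightarrow> ('v \<Rightarrow>\<^sub>0 nat) \<Rightarrow> 'b" where
  "mmon f m = (\<Prod>k\<in>Poly_Mapping.keys m. f k ^ Poly_Mapping.lookup m k)"

lemma mmon_superset:
  assumes "finite A" "Poly_Mapping.keys m \<subseteq> A"
  shows "mmon f m = (\<Prod>k\<in>A. f k ^ Poly_Mapping.lookup m k)"
  unfolding mmon_def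
  by (rule prod.mono_neutral_left) (use assms in \<open>auto simp: in_keys_iff\<close>)

lemma mmon_add: "mmon f (m + m') = mmon f m * mmon f m'"
proof -
  let ?A = "Poly_Mapping.keys m \<union> Poly_Mapping.keys m'"
  have "mmon f (m + m') = (\<Prod>k\<in>?A. f k ^ Poly_Mapping.lookup (m + m') k)"
    by (rule mmon_superset) (use keys_add[of m m'] in auto)
  also have "\<dots> = mmon f m * mmon f m'"
    by (subst (1 2) mmon_superset[of ?A]) (auto simp: lookup_add power_add prod.distrib)
  finally show ?thesis .
qed

lemma mev_mmon: "mev h f p = (\<Sum>m\<in>Poly_Mapping.keys p. h (Poly_Mapping.lookup p m) * mmon f m)"
  by (simp add: mev_def mmon_def)

lemma mev_single: "h 0 = 0 \<Longrightarrow> mev h f (Poly_Mapping.single m c) = h c * mmon f m"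
  by (cases "c = 0") (auto simp: mev_mmon)

lemma mev_superset:
  assumes "h 0 = 0" "finite A" "Poly_Mapping.keys p \<subseteq> A"
  shows "mev h f p = (\<Sum>m\<in>A. h (Poly_Mapping.lookup p m) * mmon f m)"
  unfolding mev_mmon
  by (rule sum.mono_neutral_left) (use assms in \<open>auto simp: in_keys_iff\<close>)

lemma mev_add:
  assumes "ring_morph h"
  shows "mev h f (p + q) = mev h f p + mev h f q"
proof -
  let ?A = "Poly_Mapping.keys p \<union> Poly_Mapping.keys q"
  note h = ring_morphD[OF assms]
  have "mev h f (p + q) = (\<Sum>m\<in>?A. h (Poly_Mapping.lookup (p + q) m) * mmon f m)"
    by (rule mev_superset) (use keys_add[of p q] h in auto)
  also have "\<dots> = mev h f p + mev h f q"
    by (subst (1 2) mev_superset[of h ?A]) (auto simp: h lookup_add algebra_simps sum.distrib)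
  finally show ?thesis .
qed

lemma mev_mult:
  assumes h: "ring_morph h"
  shows "mev h f (p * q) = mev h f p * mev h f q"
proof (induction p rule: poly_mapping_single_induct)
  case (single m c)
  show ?case
  proof (induction q rule: poly_mapping_single_induct)
    case (single m' c')
    show ?case by (simp add: mult_single mev_single ring_morphD[OF h] mmon_add)
  next
    case (sum p q)
    then show ?case by (simp add: distrib_left mev_add[OF h])
  qed
next
  case (sum p q)
  then show ?case by (simp add: distrib_right mev_add[OF h])
qed

lemma mev_morph: "ring_morph h \<Longrightarrow> ring_morph (mev h f)"
  unfolding ring_morph_def[of "mev h f"]
  by (auto simp: mev_add mev_mult mev_single ring_morphD mmon_def simp flip: single_one)

lemma mev_const: "ring_morph h \<Longrightarrow> mev h f (Poly_Mapping.single 0 c) = h c"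
  by (simp add: mev_single ring_morphD mmon_def)

lemma mev_var: "ring_morph h \<Longrightarrow> mev h f (Poly_Mapping.single (Poly_Mapping.single b (Suc 0)) 1) = f b"
  by (simp add: mev_single ring_morphD mmon_def)

lemma mev_PConst [simp]: "ring_morph h \<Longrightarrow> mev h f (PConst c) = h c"
  by (simp add: mev_const PConst_def)

lemma mev_PVar [simp]: "ring_morph h \<Longrightarrow> mev h f (PVar b) = f b"
  by (simp add: mev_var PVar_def)

lemma sym_induct [case_names const var add mult]:
  fixes p :: "'a::comm_ring_1 sym"
  assumes "\<And>c. P (PConst c)" "\<And>b. P (PVar b)"
    and "\<And>p q. P p \<Longrightarrow> P q \<Longrightarrow> P (p + q)" "\<And>p q. P p \<Longrightarrow> P q \<Longrightarrow> P (p * q)"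
  shows "P p"
  using assms unfolding PConst_def PVar_def by (rule mpoly_induct)

text \<open>Monomials are compared by induction on the total degree, one variable being split off at
  a time. The set \<open>B\<close> is there because the identities used later hold only on some of
  the variables.\<close>

lemma ring_morph_eqI:
  fixes f g :: "(('v \<Rightarrow>\<^sub>0 nat) \<Rightarrow>\<^sub>0 'a::comm_ring_1) \<Rightarrow> 'b::comm_ring_1"
  assumes f: "ring_morph f" and g: "ring_morph g"
    and c: "\<And>c. f (Poly_Mapping.single 0 c) = g (Poly_Mapping.single 0 c)"
    and v: "\<And>b. b \<in> B \<Longrightarrow> f (Poly_Mapping.single (Poly_Mapping.single b 1) 1) = g (Poly_Mapping.single (Poly_Mapping.single b 1) 1)"
    and p: "\<forall>m\<in>Poly_Mapping.keys p. Poly_Mapping.keys m \<subseteq> B"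
  shows "f p = g p"
proof -
  have mon: "Poly_Mapping.keys m \<subseteq> B \<Longrightarrow> f (Poly_Mapping.single m 1) = g (Poly_Mapping.single m 1)" for m
  proof (induction "\<Sum>k\<in>Poly_Mapping.keys m. Poly_Mapping.lookup m k" arbitrary: m rule: less_induct)
    case less
    show ?case
    proof (cases "m = 0")
      case True
      then show ?thesis using c[of 1] by simp
    next
      case False
      then obtain b where b: "b \<in> Poly_Mapping.keys m" by fastforce
      define m' where "m' = m - Poly_Mapping.single b 1"
      have m: "m = m' + Poly_Mapping.single b 1"
        using b by (auto intro!: poly_mapping_eqI simp: m'_def lookup_add lookup_minus lookup_single when_def in_keys_iff)
      have sub: "Poly_Mapping.keys m' \<subseteq> Poly_Mapping.keys m"
        by (auto simp: m'_def in_keys_iff lookup_minus)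
      have "(\<Sum>k\<in>Poly_Mapping.keys m'. Poly_Mapping.lookup m' k) = (\<Sum>k\<in>Poly_Mapping.keys m. Poly_Mapping.lookup m' k)"
        by (rule sum.mono_neutral_left) (use sub in \<open>auto simp: in_keys_iff\<close>)
      also have "\<dots> < (\<Sum>k\<in>Poly_Mapping.keys m. Poly_Mapping.lookup m k)"
        by (rule sum_strict_mono_ex1) (use b in \<open>auto simp: m'_def lookup_minus in_keys_iff lookup_single intro!: bexI[of _ b]\<close>)
      finally have "f (Poly_Mapping.single m' 1) = g (Poly_Mapping.single m' 1)"
        using less sub by blast
      moreover have "Poly_Mapping.single m (1::'a) = Poly_Mapping.single m' 1 * Poly_Mapping.single (Poly_Mapping.single b 1) 1"
        by (simp add: mult_single m)
      ultimately show ?thesis using v[of b] b less.prems by (auto simp: ring_morphD[OF f] ring_morphD[OF g])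
    qed
  qed
  have "p = (\<Sum>m\<in>Poly_Mapping.keys p. Poly_Mapping.single m (Poly_Mapping.lookup p m))"
    by (rule poly_mapping_sum_single)
  also have "\<dots> = (\<Sum>m\<in>Poly_Mapping.keys p. Poly_Mapping.single 0 (Poly_Mapping.lookup p m) * Poly_Mapping.single m 1)"
    by (simp add: mult_single)
  finally have e: "p = \<dots>" .
  show ?thesis
    by (subst (1 2) e) (use p mon c in \<open>simp add: ring_morph_sum f g ring_morphD[OF f] ring_morphD[OF g]\<close>)
qed

lemma ring_morph_comp: "ring_morph f \<Longrightarrow> ring_morph g \<Longrightarrow> ring_morph (\<lambda>x. f (g x))"
  by (simp add: ring_morph_def)

lemma ring_morph_id: "ring_morph (\<lambda>x. x)"
  by (simp add: ring_morph_def)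

section \<open>Polynomials in a prescribed set of variables\<close>

definition in_vars :: "'v set \<Rightarrow> (('v \<Rightarrow>\<^sub>0 nat) \<Rightarrow>\<^sub>0 'a::comm_ring_1) \<Rightarrow> bool" where
  "in_vars B p \<longleftrightarrow> (\<forall>m\<in>Poly_Mapping.keys p. Poly_Mapping.keys m \<subseteq> B)"

lemma in_vars_add: "in_vars B p \<Longrightarrow> in_vars B q \<Longrightarrow> in_vars B (p + q)"
  using keys_add[of p q] by (auto simp: in_vars_def)

lemma in_vars_uminus: "in_vars B p \<Longrightarrow> in_vars B (- p)"
  by (auto simp: in_vars_def in_keys_iff)

lemma in_vars_mult: "in_vars B p \<Longrightarrow> in_vars B q \<Longrightarrow> in_vars B (p * q)"
  using keys_mult[of p q] by (fastforce simp: in_vars_def dest!: subsetD[OF keys_add])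

lemma in_vars_const: "in_vars B (Poly_Mapping.single 0 c)"
  by (auto simp: in_vars_def)

lemma in_vars_var: "b \<in> B \<Longrightarrow> in_vars B (Poly_Mapping.single (Poly_Mapping.single b (Suc 0)) c)"
  by (auto simp: in_vars_def)

lemma in_vars_0: "in_vars B 0" and in_vars_1: "in_vars B 1"
  by (auto simp: in_vars_def)

lemma in_vars_sum: "(\<And>i. i \<in> A \<Longrightarrow> in_vars B (f i)) \<Longrightarrow> in_vars B (sum f A)"
  by (induction A rule: infinite_finite_induct) (auto intro: in_vars_add in_vars_0)

lemma in_vars_prod: "(\<And>i. i \<in> A \<Longrightarrow> in_vars B (f i)) \<Longrightarrow> in_vars B (prod f A)"
  by (induction A rule: infinite_finite_induct) (auto intro: in_vars_mult in_vars_1)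

lemma in_vars_power: "in_vars B p \<Longrightarrow> in_vars B (p ^ k)"
  by (induction k) (auto intro: in_vars_mult in_vars_1)

lemma in_vars_of_int: "in_vars B (of_int k)"
  by (metis in_vars_const single_of_int)

section \<open>Partial derivatives\<close>

text \<open>The truncated subtraction of exponents in \<open>pdv\<close> does no harm, because a
  monomial free of \<open>b\<close> gets the factor 0. Each coefficient of the derivative thus comes
  from a single monomial of \<open>p\<close>.\<close>

lemma lookup_pdv: "Poly_Mapping.lookup (pdv b p) m =
    Poly_Mapping.lookup p (m + Poly_Mapping.single b 1) * of_nat (Poly_Mapping.lookup m b + 1)"
proof -
  have 1: "m' - Poly_Mapping.single b 1 = m \<and> Poly_Mapping.lookup m' b \<noteq> 0 \<longleftrightarrow> m' = m + Poly_Mapping.single b 1" for m'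
  proof
    assume a: "m' - Poly_Mapping.single b 1 = m \<and> Poly_Mapping.lookup m' b \<noteq> 0"
    show "m' = m + Poly_Mapping.single b 1"
      by (rule poly_mapping_eqI) (use a in \<open>auto simp: lookup_add lookup_minus lookup_single when_def\<close>)
  qed (auto simp: lookup_add lookup_single intro!: poly_mapping_eqI)
  have "Poly_Mapping.lookup (pdv b p) m = (\<Sum>m'\<in>Poly_Mapping.keys p.
      if m' = m + Poly_Mapping.single b 1 then Poly_Mapping.lookup p m' * of_nat (Poly_Mapping.lookup m' b) else 0)"
    unfolding pdv_def lookup_sum lookup_single when_def
  proof (rule sum.cong[OF refl])
    fix x
    show "(if x - Poly_Mapping.single b 1 = m then Poly_Mapping.lookup p x * of_nat (Poly_Mapping.lookup x b) else 0) =
      (if x = m + Poly_Mapping.single b 1 then Poly_Mapping.lookup p x * of_nat (Poly_Mapping.lookup x b) else 0)"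
      using 1[of x] by (cases "Poly_Mapping.lookup x b = 0") (auto simp: lookup_add)
  qed
  then show ?thesis
    by (auto simp: sum.delta lookup_add in_keys_iff)
qed

lemma pdv_add: "pdv b (p + q) = pdv b p + pdv b q"
  by (rule poly_mapping_eqI) (simp add: lookup_pdv lookup_add algebra_simps)

lemma pdv_PConst [simp]: "pdv b (PConst c) = 0"
proof (rule poly_mapping_eqI)
  fix m
  have "m + Poly_Mapping.single b (1::nat) \<noteq> 0"
  proof
    assume "m + Poly_Mapping.single b 1 = 0"
    then have "Poly_Mapping.lookup (m + Poly_Mapping.single b 1) b = 0" by (simp only: lookup_zero)
    then show False by (simp add: lookup_add)
  qed
  then show "Poly_Mapping.lookup (pdv b (PConst c)) m = Poly_Mapping.lookup 0 m"
    by (simp add: lookup_pdv PConst_def lookup_single_not_eq)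
qed

lemma pdv_single: "pdv b (Poly_Mapping.single m c) =
    Poly_Mapping.single (m - Poly_Mapping.single b 1) (c * of_nat (Poly_Mapping.lookup m b))"
  by (cases "c = 0") (auto simp: pdv_def)

lemma pdv_mult: "pdv b (p * q) = p * pdv b q + pdv b p * q"
proof (induction p rule: poly_mapping_single_induct)
  case (single m c)
  show ?case
  proof (induction q rule: poly_mapping_single_induct)
    case (single m' c')
    have 1: "m + m' - Poly_Mapping.single b 1 = m + (m' - Poly_Mapping.single b 1)" if "Poly_Mapping.lookup m' b \<noteq> 0"
      by (rule poly_mapping_eqI) (use that in \<open>auto simp: lookup_add lookup_minus lookup_single when_def\<close>)
    have 2: "m + m' - Poly_Mapping.single b 1 = (m - Poly_Mapping.single b 1) + m'" if "Poly_Mapping.lookup m b \<noteq> 0"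
      by (rule poly_mapping_eqI) (use that in \<open>auto simp: lookup_add lookup_minus lookup_single when_def\<close>)
    show ?case
      using 1 2 by (cases "Poly_Mapping.lookup m b = 0"; cases "Poly_Mapping.lookup m' b = 0")
        (auto simp: pdv_single mult_single lookup_add algebra_simps simp flip: single_add)
  next
    case (sum p q)
    then show ?case by (simp add: distrib_left distrib_right pdv_add algebra_simps)
  qed
next
  case (sum p q)
  then show ?case by (simp add: distrib_left distrib_right pdv_add algebra_simps)
qed

lemma pdv_PVar: "pdv b (PVar c) = (if b = c then 1 else 0)"
  by (auto simp: PVar_def pdv_single lookup_single when_def)

lemma pdv_0 [simp]: "pdv b 0 = 0"
  by (simp add: pdv_def)

lemma pdv_uminus: "pdv b (- p) = - pdv b p"
  using pdv_add[of b p "- p"] by (simp add: eq_neg_iff_add_eq_0 add.commute)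

lemma pdv_diff: "pdv b (p - q) = pdv b p - pdv b q"
  using pdv_add[of b p "- q"] by (simp add: pdv_uminus)

lemma pdv_commute: "pdv b (pdv c p) = pdv c (pdv b p)"
proof (rule poly_mapping_eqI)
  fix m
  show "Poly_Mapping.lookup (pdv b (pdv c p)) m = Poly_Mapping.lookup (pdv c (pdv b p)) m"
    by (cases "b = c") (auto simp: lookup_pdv lookup_add lookup_single when_def algebra_simps)
qed

text \<open>In characteristic zero the exponent of an occurring variable is a nonzero scalar, so its
  term survives differentiation.\<close>

lemma pdv_zero_not_in_vars:
  fixes p :: "'a::field_char_0 sym"
  assumes "pdv b p = 0" "m \<in> Poly_Mapping.keys p"
  shows "b \<notin> Poly_Mapping.keys m"
proof
  assume b: "b \<in> Poly_Mapping.keys m"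
  define m' where "m' = m - Poly_Mapping.single b 1"
  have m: "m = m' + Poly_Mapping.single b 1"
    using b by (auto intro!: poly_mapping_eqI simp: m'_def lookup_add lookup_minus lookup_single when_def in_keys_iff)
  have "Poly_Mapping.lookup (pdv b p) m' \<noteq> 0"
    unfolding lookup_pdv m[symmetric]
    using assms(2) by (simp add: in_keys_iff flip: of_nat_Suc)
  then show False using assms(1) by simp
qed

text \<open>A bound instead of a degree, so that the zero polynomial needs no convention. It drops
  under \<open>pdv\<close> and drives the induction in \<open>V_all_zero\<close>.\<close>

definition mdeg_le :: "nat \<Rightarrow> 'a::comm_ring_1 sym \<Rightarrow> bool" where
  "mdeg_le d p \<longleftrightarrow> (\<forall>m\<in>Poly_Mapping.keys p. (\<Sum>k\<in>Poly_Mapping.keys m. Poly_Mapping.lookup m k) \<le> d)"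

lemma mdeg_le_exists: "\<exists>d. mdeg_le d p"
  unfolding mdeg_le_def
  by (meson finite_keys finite_nat_set_iff_bounded_le finite_imageI imageI)

lemma mdeg_le_pdv:
  assumes "mdeg_le (Suc d) p"
  shows "mdeg_le d (pdv b p)"
  unfolding mdeg_le_def
proof
  fix m assume "m \<in> Poly_Mapping.keys (pdv b p)"
  then have k: "m + Poly_Mapping.single b 1 \<in> Poly_Mapping.keys p"
    by (auto simp: in_keys_iff lookup_pdv)
  let ?m = "m + Poly_Mapping.single b 1"
  have "(\<Sum>k\<in>Poly_Mapping.keys m. Poly_Mapping.lookup m k) = (\<Sum>k\<in>Poly_Mapping.keys ?m. Poly_Mapping.lookup m k)"
    by (rule sum.mono_neutral_left) (auto simp: in_keys_iff lookup_add)
  also have "\<dots> < (\<Sum>k\<in>Poly_Mapping.keys ?m. Poly_Mapping.lookup ?m k)"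
    by (rule sum_strict_mono_ex1) (auto simp: lookup_add in_keys_iff intro!: exI[of _ b] bexI[of _ b])
  finally show "(\<Sum>k\<in>Poly_Mapping.keys m. Poly_Mapping.lookup m k) \<le> d"
    using assms k by (fastforce simp: mdeg_le_def)
qed

lemma mdeg_le_0_pdv:
  assumes "mdeg_le 0 p"
  shows "pdv b p = 0"
proof (rule poly_mapping_eqI)
  fix m :: "nat \<times> nat \<times> nat \<Rightarrow>\<^sub>0 nat"
  let ?m = "m + Poly_Mapping.single b 1"
  have "?m \<notin> Poly_Mapping.keys p"
  proof
    assume "?m \<in> Poly_Mapping.keys p"
    moreover have "b \<in> Poly_Mapping.keys ?m" by (simp add: in_keys_iff lookup_add)
    ultimately have "Poly_Mapping.lookup ?m b = 0"
      using assms by (auto simp: mdeg_le_def)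
    then show False by (simp add: lookup_add)
  qed
  then show "Poly_Mapping.lookup (pdv b p) m = Poly_Mapping.lookup 0 m"
    by (simp add: lookup_pdv in_keys_iff)
qed

section \<open>The Lie bracket in the basis of the centralizer\<close>

locale sorted_composition =
  fixes n :: nat and lam :: "nat \<Rightarrow> nat"
  assumes pos: "\<forall>i\<in>{1..n}. 0 < lam i"
    and sorted: "\<forall>i\<in>{1..n}. \<forall>j\<in>{1..n}. i \<le> j \<longrightarrow> lam i \<le> lam j"
begin

lemma gbasis_iff: "(i, j, r) \<in> gbasis n lam \<longleftrightarrow>
    1 \<le> i \<and> i \<le> n \<and> 1 \<le> j \<and> j \<le> n \<and> lam j \<le> r + lam i \<and> r < lam j"
  by (auto simp: gbasis_def sij_def)

lemma finite_gbasis [simp]: "finite (gbasis n lam)"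
proof (rule finite_subset)
  show "gbasis n lam \<subseteq> {1..n} \<times> {1..n} \<times> {..<\<Sum>j\<in>{1..n}. lam j}"
  proof
    fix b assume "b \<in> gbasis n lam"
    then obtain i j r where b: "b = (i, j, r)" "i \<in> {1..n}" "j \<in> {1..n}" "r < lam j"
      by (auto simp: gbasis_def)
    have "lam j \<le> (\<Sum>j\<in>{1..n}. lam j)"
      using b by (intro member_le_sum) auto
    then show "b \<in> {1..n} \<times> {1..n} \<times> {..<\<Sum>j\<in>{1..n}. lam j}"
      using b by auto
  qed
qed auto

section \<open>Boxes and products of basis elements\<close>

lemma boxnum_less:
  assumes "i < i'" "c \<le> lam i" "1 \<le> c'" "1 \<le> i"
  shows "boxnum lam i c < boxnum lam i' c'"
proof -
  have "(\<Sum>k\<in>{1..<i}. lam k) + lam i = (\<Sum>k\<in>{1..<Suc i}. lam k)"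
    using assms by simp
  also have "\<dots> \<le> (\<Sum>k\<in>{1..<i'}. lam k)"
    using assms by (intro sum_mono2) auto
  finally show ?thesis using assms by (simp add: boxnum_def)
qed

lemma boxnum_eq_iff:
  assumes "1 \<le> i" "1 \<le> i'" "1 \<le> c" "c \<le> lam i" "1 \<le> c'" "c' \<le> lam i'"
  shows "boxnum lam i c = boxnum lam i' c' \<longleftrightarrow> i = i' \<and> c = c'"
proof (cases i i' rule: linorder_cases)
  case less
  then show ?thesis using boxnum_less[of i i' c c'] assms by auto
next
  case equal
  then show ?thesis by (simp add: boxnum_def)
next
  case greater
  then show ?thesis using boxnum_less[of i' i c' c] assms by auto
qed

lemma boxnum_range:
  assumes "1 \<le> i" "i \<le> n" "1 \<le> c" "c \<le> lam i"
  shows "boxnum lam i c \<in> {1..totN n lam}"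
proof -
  have "(\<Sum>k\<in>{1..<i}. lam k) + lam i = (\<Sum>k\<in>{1..<Suc i}. lam k)"
    using assms by simp
  also have "\<dots> \<le> totN n lam"
    unfolding totN_def using assms by (intro sum_mono2) auto
  finally show ?thesis using assms by (simp add: boxnum_def)
qed

lemma emat_box:
  assumes "1 \<le> i" "1 \<le> j" "1 \<le> i'" "1 \<le> j'" "1 \<le> c" "c \<le> lam i'" "1 \<le> c'" "c' \<le> lam j'"
  shows "emat lam (i, j, r) (boxnum lam i' c) (boxnum lam j' c') =
    (if i = i' \<and> j = j' \<and> c' = c + r then 1 else 0)"
proof -
  have "(\<exists>d. 1 \<le> d \<and> d \<le> lam i \<and> d + r \<le> lam j \<and>
          boxnum lam i' c = boxnum lam i d \<and> boxnum lam j' c' = boxnum lam j (d + r))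
      \<longleftrightarrow> i = i' \<and> j = j' \<and> c' = c + r"
    using assms by (auto simp: boxnum_eq_iff)
  then show ?thesis by (simp add: emat_def)
qed

text \<open>A row of \<open>emat lam (i, j, r)\<close> indexed by a first box has at most one
  nonzero entry, in the column of box \<open>(j, 1 + r)\<close>, so the matrix product collapses to
  one term. This is the rule e_{i,j;r} e_{k,l;s} = delta_{jk} e_{i,l;r+s} in coordinates.\<close>

lemma coord_matmul:
  assumes "(i, j, r) \<in> gbasis n lam" "(k, l, s) \<in> gbasis n lam" "(i', l', t) \<in> gbasis n lam"
  shows "coord lam (i', l', t) (matmul (totN n lam) (emat lam (i, j, r)) (emat lam (k, l, s)))
    = (if j = k \<and> (i', l', t) = (i, l, r + s) then 1 else 0 :: 'a::field)"
proof -
  note a = assms[unfolded gbasis_iff]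
  have p: "1 \<le> lam i'" "1 \<le> lam i" "1 \<le> lam k" using pos a by (auto simp: Suc_le_eq)
  let ?A = "emat lam (i, j, r) (boxnum lam i' 1) :: nat \<Rightarrow> 'a"
  have A: "?A h = (if i = i' \<and> h = boxnum lam j (1 + r) then 1 else 0)" for h
  proof -
    have "(\<exists>d. 1 \<le> d \<and> d \<le> lam i \<and> d + r \<le> lam j \<and>
          boxnum lam i' 1 = boxnum lam i d \<and> h = boxnum lam j (d + r))
      \<longleftrightarrow> i = i' \<and> h = boxnum lam j (1 + r)"
      using a p by (auto simp: boxnum_eq_iff)
    then show ?thesis by (simp add: emat_def)
  qed
  have "coord lam (i', l', t) (matmul (totN n lam) (emat lam (i, j, r)) (emat lam (k, l, s))) =
    (\<Sum>h\<in>{1..totN n lam}. ?A h * emat lam (k, l, s) h (boxnum lam l' (1 + t)))"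
    by (simp add: coord_def matmul_def)
  also have "\<dots> = (\<Sum>h\<in>{1..totN n lam}. if boxnum lam j (1 + r) = h then
      (if i = i' then emat lam (k, l, s) (boxnum lam j (1 + r)) (boxnum lam l' (1 + t)) else 0) else 0)"
    unfolding A by (rule sum.cong) auto
  also have "\<dots> = (if i = i' then emat lam (k, l, s) (boxnum lam j (1 + r)) (boxnum lam l' (1 + t)) else 0)"
    using boxnum_range[of j "1 + r"] a by (subst sum.delta') auto
  also have "\<dots> = (if j = k \<and> (i', l', t) = (i, l, r + s) then 1 else 0)"
    using a by (subst emat_box) auto
  finally show ?thesis .
qed

abbreviation ev :: "nat \<times> nat \<times> nat \<Rightarrow> 'a::field sym" where "ev \<equiv> evar n lam"

text \<open>The bracket [e_{k,l;s}, e_{i,j;r}]. When a sum of exponents reaches the length of the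
  target row the matrix product is zero, and \<open>ev\<close> then returns 0.\<close>

definition brk :: "nat \<times> nat \<times> nat \<Rightarrow> nat \<times> nat \<times> nat \<Rightarrow> 'a::field sym" where
  "brk = (\<lambda>(k, l, s) (i, j, r).
      (if l = i then ev (k, j, s + r) else 0) - (if k = j then ev (i, l, s + r) else 0))"

lemma linS_mbracket:
  assumes "b \<in> gbasis n lam" "c \<in> gbasis n lam"
  shows "linS n lam (mbracket (totN n lam) (emat lam b) (emat lam c)) = (brk b c :: 'a::field sym)"
proof -
  obtain k l s where b: "b = (k, l, s)" by (metis prod_cases3)
  obtain i j r where c: "c = (i, j, r)" by (metis prod_cases3)
  note a = assms[unfolded b c]
  have co: "coord lam d (mbracket (totN n lam) (emat lam b) (emat lam c)) =
      (if l = i \<and> d = (k, j, s + r) then 1 else 0) - (if j = k \<and> d = (i, l, s + r) then 1 else 0 ::'a)"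
    if "d \<in> gbasis n lam" for d
  proof -
    obtain d1 d2 d3 where d: "d = (d1, d2, d3)" by (metis prod_cases3)
    have "coord lam d (mbracket (totN n lam) (emat lam b) (emat lam c)) =
      coord lam d (matmul (totN n lam) (emat lam b) (emat lam c)) -
      (coord lam d (matmul (totN n lam) (emat lam c) (emat lam b)) ::'a)"
      by (simp add: d coord_def mbracket_def)
    then show ?thesis
      unfolding d b c coord_matmul[OF a(1) a(2) that[unfolded d]] coord_matmul[OF a(2) a(1) that[unfolded d]]
      by (auto simp: add.commute)
  qed
  have h: "PConst ((if P \<and> d = x then 1 else 0) - (if Q \<and> d = y then 1 else 0)) * PVar d =
      (if d = x then if P then PVar x else 0 else 0) - (if d = y then if Q then PVar y else (0::'a sym) else 0)"
    for P Q and x y d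
    by (simp add: ring_morph_diff[OF PConst_morph] ring_morph_0[OF PConst_morph] ring_morph_1[OF PConst_morph])
  have "linS n lam (mbracket (totN n lam) (emat lam b) (emat lam c)) = (\<Sum>d\<in>gbasis n lam.
      (if d = (k, j, s + r) then if l = i then PVar (k, j, s + r) else 0 else 0) -
      (if d = (i, l, s + r) then if j = k then PVar (i, l, s + r) else 0 else (0::'a sym)))"
    unfolding linS_def by (rule sum.cong[OF refl]) (simp only: co h)
  also have "\<dots> = brk b c"
    by (auto simp: sum_subtractf sum.delta' brk_def b c evar_def)
  finally show ?thesis .
qed

lemma adS_brk:
  assumes "b \<in> gbasis n lam"
  shows "adS n lam b p = (\<Sum>c\<in>gbasis n lam. pdv c p * brk b c)"
  unfolding adS_def by (rule sum.cong) (simp_all add: assms linS_mbracket)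

lemma adS_add: "adS n lam b (p + q) = adS n lam b p + adS n lam b q"
  by (simp add: adS_def pdv_add distrib_right sum.distrib)

lemma adS_mult: "adS n lam b (p * q) = p * adS n lam b q + adS n lam b p * q"
  by (simp add: adS_def pdv_mult distrib_right sum.distrib sum_distrib_left sum_distrib_right mult.assoc mult.commute
     mult.left_commute)

lemma adS_diff: "adS n lam b (p - q) = adS n lam b p - adS n lam b q"
  by (simp add: adS_def pdv_diff left_diff_distrib sum_subtractf)

lemma adS_0: "adS n lam b 0 = 0"
  by (simp add: adS_def)

lemma adS_PConst: "adS n lam b (PConst c) = 0"
  by (simp add: adS_def)

lemma adS_ev:
  fixes c :: "nat \<times> nat \<times> nat"
  assumes "b \<in> gbasis n lam"
  shows "adS n lam b (ev c :: 'a::field sym) = (if c \<in> gbasis n lam then brk b c else 0)"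
proof -
  have "(\<Sum>d\<in>gbasis n lam. pdv d (PVar c) * brk b d) = (\<Sum>d\<in>gbasis n lam. if d = c then brk b d else (0::'a sym))"
    by (rule sum.cong) (auto simp: pdv_PVar)
  then show ?thesis
    using assms by (auto simp: evar_def adS_0 adS_brk sum.delta)
qed

section \<open>The invariants form a subalgebra\<close>

lemma Sge_iff: "p \<in> Sge n lam \<longleftrightarrow> in_vars (gbasis n lam) p"
  by (simp add: Sge_def in_vars_def)

lemma in_vars_ev: "in_vars (gbasis n lam) (ev c)"
  by (auto simp: evar_def PVar_def in_vars_var in_vars_0)

lemma InvS_add: "p \<in> InvS n lam \<Longrightarrow> q \<in> InvS n lam \<Longrightarrow> p + q \<in> InvS n lam"
  by (simp add: InvS_def Sge_iff in_vars_add adS_add)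

lemma InvS_diff: "p \<in> InvS n lam \<Longrightarrow> q \<in> InvS n lam \<Longrightarrow> p - q \<in> InvS n lam"
  using in_vars_add[of "gbasis n lam" p "- q"] in_vars_uminus[of "gbasis n lam" q]
  by (simp add: InvS_def Sge_iff adS_diff)

lemma InvS_mult: "p \<in> InvS n lam \<Longrightarrow> q \<in> InvS n lam \<Longrightarrow> p * q \<in> InvS n lam"
  by (simp add: InvS_def Sge_iff in_vars_mult adS_mult)

lemma InvS_PConst: "PConst c \<in> InvS n lam"
  by (simp add: InvS_def Sge_iff adS_PConst) (simp add: PConst_def in_vars_const)

lemma InvS_1: "1 \<in> InvS n lam"
  using InvS_PConst[of 1] by (simp add: ring_morph_1[OF PConst_morph])

lemma InvS_sum: "(\<And>i. i \<in> A \<Longrightarrow> f i \<in> InvS n lam) \<Longrightarrow> sum f A \<in> InvS n lam"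
  using InvS_PConst[of 0]
  by (induction A rule: infinite_finite_induct) (auto intro: InvS_add simp: ring_morph_0[OF PConst_morph])

lemma InvS_power: "p \<in> InvS n lam \<Longrightarrow> p ^ k \<in> InvS n lam"
  by (induction k) (auto intro: InvS_mult InvS_1)

lemma InvS_prod: "(\<And>i. i \<in> A \<Longrightarrow> f i \<in> InvS n lam) \<Longrightarrow> prod f A \<in> InvS n lam"
  by (induction A rule: infinite_finite_induct) (auto intro: InvS_mult InvS_1)

lemma InvS_peval:
  assumes "\<forall>m\<in>Poly_Mapping.keys Q. Poly_Mapping.keys m \<subseteq> A" "\<And>r. r \<in> A \<Longrightarrow> x r \<in> InvS n lam"
  shows "peval Q x \<in> InvS n lam"
  unfolding peval_def
  by (intro InvS_sum InvS_mult InvS_PConst InvS_prod InvS_power) (use assms in auto)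

end

section \<open>Determinants and derivations\<close>

definition pdet :: "'i set \<Rightarrow> ('i \<Rightarrow> 'i \<Rightarrow> 'r::comm_ring_1) \<Rightarrow> 'r" where
  "pdet S M = (\<Sum>p\<in>{p. p permutes S}. of_int (sign p) * (\<Prod>i\<in>S. M (p i) i))"

text \<open>The differential of the determinant at \<open>M\<close> in the direction
  \<open>X\<close>, that is, the trace of adj(M) X.\<close>

definition ldet :: "'i set \<Rightarrow> ('i \<Rightarrow> 'i \<Rightarrow> 'r::comm_ring_1) \<Rightarrow> ('i \<Rightarrow> 'i \<Rightarrow> 'r) \<Rightarrow> 'r" where
  "ldet S M X = (\<Sum>p\<in>{p. p permutes S}. of_int (sign p) * (\<Sum>j\<in>S. X (p j) j * (\<Prod>i\<in>S - {j}. M (p i) i)))"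

text \<open>Composition with the transposition of \<open>k\<close> and \<open>l\<close> flips every
  sign and keeps every product, so the determinant is its own negative; \<open>two\<close> then
  makes it vanish.\<close>

lemma pdet_equal_rows:
  fixes M :: "'i \<Rightarrow> 'i \<Rightarrow> 'r::comm_ring_1"
  assumes S: "finite S" "k \<in> S" "l \<in> S" "k \<noteq> l" and eq: "\<And>j. M k j = M l j"
    and two: "\<And>x::'r. x + x = 0 \<Longrightarrow> x = 0"
  shows "pdet S M = 0"
proof -
  let ?t = "Transposition.transpose k l"
  have t: "?t permutes S" using S by (intro permutes_swap_id)
  have "pdet S M = (\<Sum>p\<in>{p. p permutes S}. of_int (sign (?t \<circ> p)) * (\<Prod>i\<in>S. M ((?t \<circ> p) i) i))"
    unfolding pdet_def
    by (rule sum.reindex_bij_witness[of _ "\<lambda>p. ?t \<circ> p" "\<lambda>p. ?t \<circ> p"])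
       (auto intro: permutes_compose t simp flip: comp_assoc)
  also have "\<dots> = (\<Sum>p\<in>{p. p permutes S}. - (of_int (sign p) * (\<Prod>i\<in>S. M (p i) i)))"
  proof (rule sum.cong[OF refl])
    fix p assume "p \<in> {p. p permutes S}"
    then have "permutation p" using S(1) permutation_permutes by blast
    then have "sign (?t \<circ> p) = - sign p"
      using S by (simp add: sign_compose sign_swap_id permutation_swap_id)
    moreover have "M ((?t \<circ> p) i) i = M (p i) i" for i
      using eq by (auto simp: Transposition.transpose_def)
    ultimately show "of_int (sign (?t \<circ> p)) * (\<Prod>i\<in>S. M ((?t \<circ> p) i) i) =
        - (of_int (sign p) * (\<Prod>i\<in>S. M (p i) i))" by simp
  qed
  also have "\<dots> = - pdet S M" by (simp add: pdet_def sum_negf)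
  finally show ?thesis by (metis two add.right_inverse)
qed

lemma pdet_equal_cols:
  fixes M :: "'i \<Rightarrow> 'i \<Rightarrow> 'r::comm_ring_1"
  assumes S: "finite S" "k \<in> S" "l \<in> S" "k \<noteq> l" and eq: "\<And>i. M i k = M i l"
    and two: "\<And>x::'r. x + x = 0 \<Longrightarrow> x = 0"
  shows "pdet S M = 0"
proof -
  let ?t = "Transposition.transpose k l"
  have t: "?t permutes S" using S by (intro permutes_swap_id)
  have "pdet S M = (\<Sum>p\<in>{p. p permutes S}. of_int (sign (p \<circ> ?t)) * (\<Prod>i\<in>S. M ((p \<circ> ?t) i) i))"
    unfolding pdet_def
    by (rule sum.reindex_bij_witness[of _ "\<lambda>p. p \<circ> ?t" "\<lambda>p. p \<circ> ?t"])
       (auto intro: permutes_compose t simp: comp_assoc)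
  also have "\<dots> = (\<Sum>p\<in>{p. p permutes S}. - (of_int (sign p) * (\<Prod>i\<in>S. M (p i) i)))"
  proof (rule sum.cong[OF refl])
    fix p assume "p \<in> {p. p permutes S}"
    then have "permutation p" using S(1) permutation_permutes by blast
    then have "sign (p \<circ> ?t) = - sign p"
      using S by (simp add: sign_compose sign_swap_id permutation_swap_id)
    moreover have "(\<Prod>i\<in>S. M ((p \<circ> ?t) i) i) = (\<Prod>i\<in>S. M (p i) i)"
    proof -
      have "(\<Prod>i\<in>S. M (p (?t i)) i) = (\<Prod>i\<in>S. M (p i) (?t i))"
        by (subst prod.permute[OF t]) (simp add: o_def)
      also have "\<dots> = (\<Prod>i\<in>S. M (p i) i)"
        by (rule prod.cong) (use eq in \<open>auto simp: Transposition.transpose_def\<close>)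
      finally show ?thesis by simp
    qed
    ultimately show "of_int (sign (p \<circ> ?t)) * (\<Prod>i\<in>S. M ((p \<circ> ?t) i) i) =
        - (of_int (sign p) * (\<Prod>i\<in>S. M (p i) i))" by simp
  qed
  also have "\<dots> = - pdet S M" by (simp add: pdet_def sum_negf)
  finally show ?thesis by (metis two add.right_inverse)
qed

lemma ldet_diff: "ldet S M (\<lambda>i j. X i j - Y i j) = ldet S M X - ldet S M Y"
  by (simp add: ldet_def left_diff_distrib right_diff_distrib sum_subtractf)

text \<open>An infinitesimal row operation: its effect is \<open>a\<close> times the determinant of
  \<open>M\<close> with row \<open>l\<close> replaced by row \<open>k\<close>, a matrix with two
  equal rows unless \<open>k = l\<close>.\<close>

lemma ldet_row:
  fixes M :: "'i \<Rightarrow> 'i \<Rightarrow> 'r::comm_ring_1"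
  assumes S: "finite S" "k \<in> S" "l \<in> S" and two: "\<And>x::'r. x + x = 0 \<Longrightarrow> x = 0"
  shows "ldet S M (\<lambda>i j. if i = l then a * M k j else 0) = (if k = l then a * pdet S M else 0)"
proof -
  define M' where "M' i j = M (if i = l then k else i) j" for i j
  have "(\<Sum>j\<in>S. (if p j = l then a * M k j else 0) * (\<Prod>i\<in>S - {j}. M (p i) i)) = a * (\<Prod>i\<in>S. M' (p i) i)"
    if p: "p permutes S" for p
  proof -
    obtain j0 where j0: "j0 \<in> S" "p j0 = l"
      using p S by (metis imageE permutes_image)
    have u: "p j = l \<longleftrightarrow> j = j0" for j
      using j0 p by (metis permutes_inj injD)
    have "(\<Sum>j\<in>S. (if p j = l then a * M k j else 0) * (\<Prod>i\<in>S - {j}. M (p i) i)) =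
      (\<Sum>j\<in>S. if j = j0 then a * M k j0 * (\<Prod>i\<in>S - {j0}. M (p i) i) else 0)"
      by (rule sum.cong) (auto simp: u)
    also have "\<dots> = a * (M k j0 * (\<Prod>i\<in>S - {j0}. M (p i) i))"
      using S j0 by (simp add: sum.delta mult.assoc)
    also have "M k j0 * (\<Prod>i\<in>S - {j0}. M (p i) i) = (\<Prod>i\<in>S. M' (p i) i)"
      by (subst prod.remove[OF S(1) j0(1)]) (auto simp: M'_def u j0 intro!: prod.cong)
    finally show ?thesis .
  qed
  then have "ldet S M (\<lambda>i j. if i = l then a * M k j else 0) = a * pdet S M'"
    by (simp add: ldet_def pdet_def sum_distrib_left mult.left_commute)
  moreover have "pdet S M' = 0" if "k \<noteq> l"
    by (rule pdet_equal_rows[of S k l]) (use that S two in \<open>auto simp: M'_def\<close>)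
  moreover have "M' = M" if "k = l" using that by (auto simp: M'_def fun_eq_iff)
  ultimately show ?thesis by auto
qed

text \<open>The column counterpart of \<open>ldet_row\<close>, with column \<open>l\<close> put in
  place of column \<open>k\<close>.\<close>

lemma ldet_col:
  fixes M :: "'i \<Rightarrow> 'i \<Rightarrow> 'r::comm_ring_1"
  assumes S: "finite S" "k \<in> S" "l \<in> S" and two: "\<And>x::'r. x + x = 0 \<Longrightarrow> x = 0"
  shows "ldet S M (\<lambda>i j. if j = k then a * M i l else 0) = (if k = l then a * pdet S M else 0)"
proof -
  define M' where "M' i j = M i (if j = k then l else j)" for i j
  have "(\<Sum>j\<in>S. (if j = k then a * M (p j) l else 0) * (\<Prod>i\<in>S - {j}. M (p i) i)) = a * (\<Prod>i\<in>S. M' (p i) i)" for p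
  proof -
    have "(\<Sum>j\<in>S. (if j = k then a * M (p j) l else 0) * (\<Prod>i\<in>S - {j}. M (p i) i)) =
      (\<Sum>j\<in>S. if j = k then a * M (p k) l * (\<Prod>i\<in>S - {k}. M (p i) i) else 0)"
      by (rule sum.cong) auto
    also have "\<dots> = a * (M (p k) l * (\<Prod>i\<in>S - {k}. M (p i) i))"
      using S by (simp add: sum.delta mult.assoc)
    also have "M (p k) l * (\<Prod>i\<in>S - {k}. M (p i) i) = (\<Prod>i\<in>S. M' (p i) i)"
      by (subst prod.remove[OF S(1) S(2)]) (auto simp: M'_def intro!: prod.cong)
    finally show ?thesis .
  qed
  then have "ldet S M (\<lambda>i j. if j = k then a * M i l else 0) = a * pdet S M'"
    by (simp add: ldet_def pdet_def sum_distrib_left mult.left_commute)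
  moreover have "pdet S M' = 0" if "k \<noteq> l"
    by (rule pdet_equal_cols[of S k l]) (use that S two in \<open>auto simp: M'_def\<close>)
  moreover have "M' = M" if "k = l" using that by (auto simp: M'_def fun_eq_iff)
  ultimately show ?thesis by auto
qed

section \<open>Derivations and their action on determinants\<close>

definition derivation :: "('r::comm_ring_1 \<Rightarrow> 'r) \<Rightarrow> bool" where
  "derivation D \<longleftrightarrow> (\<forall>x y. D (x + y) = D x + D y) \<and> (\<forall>x y. D (x * y) = x * D y + D x * y)"

lemma derivationD:
  assumes "derivation D"
  shows derivation_add: "D (x + y) = D x + D y" and derivation_mult: "D (x * y) = x * D y + D x * y"
    and derivation_0: "D 0 = 0" and derivation_1: "D 1 = 0" and derivation_uminus: "D (- x) = - D x"
proof -
  show a: "D (x + y) = D x + D y" and m: "D (x * y) = x * D y + D x * y" for x y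
    using assms by (auto simp: derivation_def)
  show 0: "D 0 = 0" using a[of 0 0] by simp
  show "D 1 = 0" using m[of 1 1] by simp
  show "D (- x) = - D x" using a[of x "- x"] 0 by (simp add: eq_neg_iff_add_eq_0 add.commute)
qed

lemma derivation_sum: "derivation D \<Longrightarrow> D (sum f A) = (\<Sum>i\<in>A. D (f i))"
  by (induction A rule: infinite_finite_induct) (auto simp: derivationD)

lemma derivation_prod:
  assumes D: "derivation D" and A: "finite A"
  shows "D (prod f A) = (\<Sum>j\<in>A. D (f j) * prod f (A - {j}))"
  using A
proof (induction A rule: finite_induct)
  case (insert x A)
  have "(\<Sum>j\<in>A. D (f j) * prod f (insert x A - {j})) = (\<Sum>j\<in>A. f x * (D (f j) * prod f (A - {j})))"
  proof (rule sum.cong[OF refl])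
    fix j assume "j \<in> A"
    then have "insert x A - {j} = insert x (A - {j})" using insert by auto
    then show "D (f j) * prod f (insert x A - {j}) = f x * (D (f j) * prod f (A - {j}))"
      using insert by (simp add: mult_ac)
  qed
  then show ?case
    using insert by (simp add: derivation_mult[OF D] sum_distrib_left)
qed (simp add: derivation_1[OF D])

lemma derivation_pdet:
  assumes D: "derivation D" and S: "finite S"
  shows "D (pdet S M) = ldet S M (\<lambda>i j. D (M i j))"
proof -
  have s: "D (of_int (sign p) * x) = of_int (sign p) * D x" for p :: "'b \<Rightarrow> 'b" and x
    by (simp add: sign_def derivationD[OF D])
  show ?thesis
    by (simp add: pdet_def ldet_def derivation_sum[OF D] s derivation_prod[OF D S])
qed

lemma derivation_map_poly:
  assumes D: "derivation D"
  shows "derivation (map_poly D)"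
  unfolding derivation_def
proof (intro conjI allI)
  note d = derivationD[OF D]
  fix x y
  show "map_poly D (x + y) = map_poly D x + map_poly D y"
    by (rule poly_eqI) (simp add: coeff_map_poly d)
  show "map_poly D (x * y) = x * map_poly D y + map_poly D x * y"
    by (rule poly_eqI) (simp add: coeff_map_poly d coeff_mult derivation_sum[OF D] sum.distrib)
qed

text \<open>In \<open>'r poly poly\<close> the index \<open>c\<close> is the exponent of the outer
  variable u and \<open>a\<close> that of the inner variable y.\<close>

lemma coeff2_mult_nonzero:
  assumes "coeff (coeff (P * Q) c) a \<noteq> 0"
  obtains c1 c2 a1 a2 where "c = c1 + c2" "a = a1 + a2"
    "coeff (coeff P c1) a1 \<noteq> 0" "coeff (coeff Q c2) a2 \<noteq> 0"
proof -
  have "(\<Sum>i\<le>c. \<Sum>j\<le>a. coeff (coeff P i) j * coeff (coeff Q (c - i)) (a - j)) \<noteq> 0"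
    using assms by (simp add: coeff_mult coeff_sum)
  then obtain i where i: "i \<le> c" "(\<Sum>j\<le>a. coeff (coeff P i) j * coeff (coeff Q (c - i)) (a - j)) \<noteq> 0"
    by (meson sum.not_neutral_contains_not_neutral atMost_iff)
  then obtain j where j: "j \<le> a" "coeff (coeff P i) j * coeff (coeff Q (c - i)) (a - j) \<noteq> 0"
    by (meson sum.not_neutral_contains_not_neutral atMost_iff)
  show ?thesis
    by (rule that[of i "c - i" j "a - j"]) (use i j in auto)
qed

lemma coeff2_sign_mult:
  "coeff (coeff (of_int (sign p) * P) c) a = of_int (sign p) * coeff (coeff P c) a"
  by (simp add: sign_def)

lemma prod_monom: "(\<Prod>i\<in>A. monom (f i) (g i)) = monom (\<Prod>i\<in>A. f i) (\<Sum>i\<in>A. g i :: nat)"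
  by (induction A rule: infinite_finite_induct) (auto simp: mult_monom)

lemma double_eq_0_poly_poly_sym:
  fixes P :: "'a::field_char_0 sym poly poly"
  assumes "P + P = 0"
  shows "P = 0"
proof (intro poly_eqI poly_mapping_eqI)
  fix c a m
  have "Poly_Mapping.lookup (coeff (coeff (P + P) c) a) m = 0" by (simp add: assms)
  then show "Poly_Mapping.lookup (coeff (coeff P c) a) m = Poly_Mapping.lookup (coeff (coeff 0 c) a) m"
    by (simp only: coeff_add lookup_add) simp
qed

section \<open>Invariance\<close>

text \<open>For a nondecreasing \<open>f\<close> the initial segment has the least sum among index
  sets of its size. The induction removes the largest index.\<close>

lemma sum_smallest_le:
  fixes f :: "nat \<Rightarrow> nat"
  assumes "\<forall>i\<in>{1..n}. \<forall>j\<in>{1..n}. i \<le> j \<longrightarrow> f i \<le> f j" "B \<subseteq> {1..n}"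
  shows "(\<Sum>i\<in>{1..card B}. f i) \<le> sum f B"
  using assms
proof (induction n arbitrary: B)
  case (Suc n)
  have f: "\<forall>i\<in>{1..n}. \<forall>j\<in>{1..n}. i \<le> j \<longrightarrow> f i \<le> f j" using Suc.prems by auto
  have fin: "finite B" by (rule finite_subset[OF Suc.prems(2)]) simp
  show ?case
  proof (cases "Suc n \<in> B")
    case True
    define C where "C = B - {Suc n}"
    have C: "C \<subseteq> {1..n}" using Suc.prems by (auto simp: C_def)
    have cB: "card B = Suc (card C)" using card_Suc_Diff1[OF fin True] by (simp add: C_def)
    have cC: "card C \<le> n" using card_mono[OF _ C] by simp
    have "(\<Sum>i\<in>{1..card B}. f i) = (\<Sum>i\<in>{1..card C}. f i) + f (Suc (card C))"
      by (simp add: cB)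
    also have "\<dots> \<le> sum f C + f (Suc n)"
      using Suc.IH[OF f C] Suc.prems(1) cC by (intro add_mono) auto
    also have "\<dots> = sum f B"
      using sum.remove[OF fin True, of f] by (simp add: C_def)
    finally show ?thesis .
  next
    case False
    then have "B \<subseteq> {1..n}" using Suc.prems(2) by (metis atLeastAtMostSuc_conv le_add1 plus_1_eq_Suc subset_insert)
    then show ?thesis using Suc.IH f by blast
  qed
qed simp

context sorted_composition
begin

text \<open>The summation index \<open>m\<close> plays the role of \<open>mu j\<close>:
  \<open>m = 0\<close> selects the diagonal term y u^(lam j), and \<open>m > 0\<close> selects
  e_{i,j;m-1} u^(lam j - m).\<close>

definition Mat :: "nat \<Rightarrow> nat \<Rightarrow> 'a::field sym poly poly" where
  "Mat i j = (\<Sum>m\<in>{0..lam j}. monom (monom (if m = 0 then (if i = j then 1 else 0) else ev (i, j, m - 1))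
      (if m = 0 then 1 else 0)) (lam j - m))"

lemma coeff_Mat: "coeff (Mat i j) c = (if c < lam j then monom (ev (i, j, lam j - 1 - c)) 0
    else if c = lam j \<and> i = j then monom 1 1 else 0)"
proof -
  have "coeff (Mat i j) c = (\<Sum>m\<in>{0..lam j}. if m = lam j - c then (if c \<le> lam j then
     monom (if m = 0 then (if i = j then 1 else 0) else ev (i, j, m - 1)) (if m = 0 then 1 else 0) else 0) else (0::'a sym poly))"
    unfolding Mat_def coeff_sum by (rule sum.cong) auto
  then show ?thesis by (auto simp: sum.delta)
qed

lemma adS_derivation: "derivation (adS n lam b)"
  by (simp add: derivation_def adS_add adS_mult)

text \<open>\<open>X\<close> is the infinitesimal operation A M - M B on rows and columns. At
  exponents of u below \<open>min (lam i) (lam j)\<close> the variable in question lies in the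
  basis, so the derivation is given by the bracket and agrees with \<open>X\<close>.\<close>

lemma Mat_derivative_error:
  fixes X :: "nat \<Rightarrow> nat \<Rightarrow> 'a::field sym poly poly"
  assumes b: "(k, l, s) \<in> gbasis n lam" and ij: "i \<in> {1..n}" "j \<in> {1..n}"
    and X: "X = (\<lambda>i j. (if i = l then monom 1 s * Mat k j else 0)
                - (if j = k then monom 1 (s + lam k - lam l) * Mat i l else 0))"
    and nz: "coeff (coeff (map_poly (map_poly (adS n lam (k, l, s))) (Mat i j) - X i j) c) a \<noteq> 0"
  shows "a = 0 \<and> min (lam i) (lam j) \<le> c"
proof (rule ccontr)
  let ?D = "adS n lam (k, l, s) :: 'a sym \<Rightarrow> _"
  note D = derivationD[OF adS_derivation]
  assume neg: "\<not> (a = 0 \<and> min (lam i) (lam j) \<le> c)"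
  note b' = b[unfolded gbasis_iff]
  have L: "coeff (coeff (map_poly (map_poly ?D) (Mat i j)) c) a =
      (if a = 0 \<and> c < lam j then ?D (ev (i, j, lam j - 1 - c)) else 0)"
    by (auto simp: coeff_map_poly D coeff_Mat)
  have R1: "coeff (coeff (monom 1 s * Mat k j) c) a =
      (if c < s then 0 else if c - s < lam j then (if a = 0 then ev (k, j, lam j - 1 - (c - s)) else 0)
       else if c - s = lam j \<and> k = j \<and> a = 1 then 1 else (0::'a sym))"
    by (auto simp: coeff_monom_mult coeff_Mat)
  \<comment> \<open>The subtraction is exact: \<open>(k, l, s)\<close> lies in the basis, hence
    \<open>lam l \<le> s + lam k\<close>.\<close>
  let ?u = "s + lam k - lam l"
  have R2: "coeff (coeff (monom 1 ?u * Mat i l) c) a =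
      (if c < ?u then 0 else if c - ?u < lam l then (if a = 0 then ev (i, l, lam l - 1 - (c - ?u)) else 0)
       else if c - ?u = lam l \<and> i = l \<and> a = 1 then 1 else (0::'a sym))"
    by (auto simp: coeff_monom_mult coeff_Mat)
  show False
  proof (cases "a = 0")
    case True
    then have c: "c < lam i" "c < lam j" using neg by auto
    define r where "r = lam j - 1 - c"
    \<comment> \<open>For this \<open>r\<close>, the bound \<open>c < lam i\<close> says exactly
      that r is at least s_{i,j}.\<close>
    have "(i, j, r) \<in> gbasis n lam" using c ij by (auto simp: gbasis_iff r_def)
    then have L': "coeff (coeff (map_poly (map_poly ?D) (Mat i j)) c) a =
       (if l = i then ev (k, j, s + r) else 0) - (if k = j then ev (i, l, s + r) else 0)"
      using L True c b by (simp add: adS_ev r_def brk_def)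
    have R1': "coeff (coeff (monom 1 s * Mat k j) c) a = (ev (k, j, s + r) :: 'a sym)"
    proof (cases "c < s")
      case True
      then have "lam j \<le> s + r" using c by (simp add: r_def)
      then show ?thesis using True R1 by (simp add: evar_def gbasis_iff)
    next
      case False
      then have "lam j - 1 - (c - s) = s + r" using c by (simp add: r_def)
      then show ?thesis using False R1 c True by simp
    qed
    have R2': "coeff (coeff (monom 1 ?u * Mat i l) c) a = (ev (i, l, s + r) :: 'a sym)" if "j = k"
    proof (cases "c < ?u")
      case True
      then have "lam l \<le> s + r" using c that by (simp add: r_def)
      then show ?thesis using True R2 by (simp add: evar_def gbasis_iff)
    next
      case False
      then have "lam l - 1 - (c - ?u) = s + r" "c - ?u < lam l" using c that b' by (auto simp: r_def)
      then show ?thesis using False R2 True by simp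
    qed
    show False using nz L' R1' R2' by (auto simp: X split: if_splits)
  next
    case False
    \<comment> \<open>A positive power of y can enter \<open>X\<close> only at the entry
      \<open>(l, k)\<close>, where both operations produce y u^(s + lam k) and cancel.\<close>
    have "coeff (coeff (if i = l then monom 1 s * Mat k j else 0) c) a =
        (if i = l \<and> j = k \<and> a = 1 \<and> c = s + lam k then 1 else (0::'a sym))"
      using R1 False by auto
    moreover have "coeff (coeff (if j = k then monom 1 ?u * Mat i l else 0) c) a =
        (if i = l \<and> j = k \<and> a = 1 \<and> c = s + lam k then 1 else (0::'a sym))"
      using R2 False b' by auto
    ultimately have "coeff (coeff (X i j) c) a = 0"
      by (simp add: X)
    then show False using nz L False by simp
  qed
qed

text \<open>A power of y arises only from diagonal entries, one y at a time, each accompanied by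
  u^(lam i). \<open>B\<close> collects the fixed points where that term is chosen.\<close>

lemma coeff_prod_Mat:
  fixes c a :: nat
  defines "M \<equiv> Mat :: nat \<Rightarrow> nat \<Rightarrow> 'a::field sym poly poly"
  assumes "finite A" "coeff (coeff (\<Prod>i\<in>A. M (q i) i) c) a \<noteq> 0"
  shows "\<exists>B\<subseteq>{i\<in>A. q i = i}. card B = a \<and> sum lam B \<le> c"
  using assms(2,3)
proof (induction A arbitrary: c a rule: finite_induct)
  case empty
  then show ?case by (cases "c = 0"; cases "a = 0") auto
next
  case (insert x A)
  then have "coeff (coeff (M (q x) x * (\<Prod>i\<in>A. M (q i) i)) c) a \<noteq> 0" by simp
  then obtain c1 c2 a1 a2 where ca: "c = c1 + c2" "a = a1 + a2"
    and 1: "coeff (coeff (M (q x) x) c1) a1 \<noteq> 0" and 2: "coeff (coeff (\<Prod>i\<in>A. M (q i) i) c2) a2 \<noteq> 0"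
    by (rule coeff2_mult_nonzero)
  obtain B where B: "B \<subseteq> {i\<in>A. q i = i}" "card B = a2" "sum lam B \<le> c2"
    using insert.IH[OF 2] by blast
  have fB: "finite B" "x \<notin> B" using B insert by (auto intro: finite_subset)
  have "a1 = 0 \<or> a1 = 1 \<and> q x = x \<and> c1 = lam x"
    using 1 by (auto simp: M_def coeff_Mat split: if_splits)
  then show ?case
  proof
    assume "a1 = 0"
    then show ?thesis using B ca by (intro exI[of _ B]) auto
  next
    assume "a1 = 1 \<and> q x = x \<and> c1 = lam x"
    then show ?thesis using B ca fB by (intro exI[of _ "insert x B"]) auto
  qed
qed

text \<open>Only the error term of \<open>Mat_derivative_error\<close> can contribute. It costs the
  smaller of two parts in the exponent of u, and the \<open>a\<close> factors y cost the parts at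
  \<open>a\<close> further indices. So the exponent of u is at least the sum of the
  \<open>a + 1\<close> smallest parts.\<close>

lemma adS_coeff_pdet:
  assumes b: "(k, l, s) \<in> gbasis n lam" and c: "c < (\<Sum>i\<in>{1..a + 1}. lam i)"
  shows "adS n lam (k, l, s) (coeff (coeff (pdet {1..n} Mat) c) a) = (0 :: 'a::field_char_0 sym)"
proof -
  let ?D = "adS n lam (k, l, s) :: 'a sym \<Rightarrow> _"
  let ?M = "Mat :: nat \<Rightarrow> nat \<Rightarrow> 'a sym poly poly"
  let ?D2 = "map_poly (map_poly ?D)"
  note D = derivationD[OF adS_derivation]
  note b' = b[unfolded gbasis_iff]
  define X where "X = (\<lambda>i j. (if i = l then monom 1 s * Mat k j else 0)
                - (if j = k then monom 1 (s + lam k - lam l) * Mat i l else (0 :: 'a sym poly poly)))"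
  define T where "T i j = ?D2 (Mat i j) - X i j" for i j
  have kl: "k \<in> {1..n}" "l \<in> {1..n}" using b' by auto
  \<comment> \<open>For \<open>k = l\<close> both operations contribute u^s times the determinant,
    and for \<open>k \<noteq> l\<close> both contribute nothing: A and B have equal traces.\<close>
  have X0: "ldet {1..n} Mat X = 0"
    unfolding X_def ldet_diff
    by (subst ldet_row[OF _ kl double_eq_0_poly_poly_sym], simp, assumption,
        subst ldet_col[OF _ kl double_eq_0_poly_poly_sym], simp, assumption) auto
  have D2: "derivation ?D2"
    by (intro derivation_map_poly adS_derivation)
  have e: "?D (coeff (coeff (pdet {1..n} Mat) c) a) = coeff (coeff (ldet {1..n} Mat T) c) a"
  proof -
    have "?D (coeff (coeff (pdet {1..n} Mat) c) a) = coeff (coeff (?D2 (pdet {1..n} Mat)) c) a"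
      by (simp add: coeff_map_poly D)
    also have "?D2 (pdet {1..n} Mat) = ldet {1..n} Mat (\<lambda>i j. ?D2 (Mat i j))"
      by (intro derivation_pdet D2) simp
    also have "\<dots> = ldet {1..n} Mat T"
      unfolding T_def[abs_def] ldet_diff X0 by simp
    finally show ?thesis .
  qed
  have "coeff (coeff (T (p j) j * (\<Prod>i\<in>{1..n} - {j}. ?M (p i) i)) c) a = 0"
    if p: "p permutes {1..n}" and j: "j \<in> {1..n}" for p j
  proof (rule ccontr)
    assume nz: "\<not> ?thesis"
    obtain c1 c2 a1 a2 where ca: "c = c1 + c2" "a = a1 + a2"
      and 1: "coeff (coeff (T (p j) j) c1) a1 \<noteq> 0"
      and 2: "coeff (coeff (\<Prod>i\<in>{1..n} - {j}. ?M (p i) i) c2) a2 \<noteq> 0"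
      by (rule coeff2_mult_nonzero[OF nz])
    have pj: "p j \<in> {1..n}" using p j by (simp only: permutes_in_image)
    have a1: "a1 = 0" "min (lam (p j)) (lam j) \<le> c1"
      using Mat_derivative_error[OF b pj j X_def] 1 unfolding T_def by blast+
    obtain B where B: "B \<subseteq> {i\<in>{1..n} - {j}. p i = i}" "card B = a2" "sum lam B \<le> c2"
      using coeff_prod_Mat[OF _ 2] by auto
    have "p j \<notin> B"
    proof
      assume "p j \<in> B"
      then have "p (p j) = p j" "p j \<noteq> j" using B by auto
      then show False using permutes_inj[OF p] by (auto dest: injD)
    qed
    moreover have "j \<notin> B" using B by auto
    \<comment> \<open>\<open>x\<close> is whichever of the row and column index has the smaller
      part. It lies outside \<open>B\<close>, so \<open>insert x B\<close> has \<open>a + 1\<close>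
      elements.\<close>
    moreover obtain x where x: "x = j \<or> x = p j" "lam x = min (lam (p j)) (lam j)"
      by (metis min_def)
    ultimately have xB: "x \<notin> B" by auto
    have fB: "finite B" using B(1) finite_subset by fastforce
    have sub: "insert x B \<subseteq> {1..n}" using B x j pj by auto
    have "(\<Sum>i\<in>{1..a + 1}. lam i) \<le> sum lam (insert x B)"
      using sum_smallest_le[OF sorted sub] xB fB B ca a1 by simp
    also have "\<dots> \<le> c" using xB fB B ca a1 x by simp
    finally show False using c by simp
  qed
  then have "coeff (coeff (ldet {1..n} Mat T) c) a = 0"
    unfolding ldet_def coeff_sum coeff2_sign_mult by (intro sum.neutral) simp
  then show ?thesis by (simp only: e)
qed

section \<open>The generators as coefficients of the determinant\<close>

lemma finite_subcomps: "finite (subcomps n lam)"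
proof (rule finite_subset)
  show "subcomps n lam \<subseteq> {mu. \<forall>i. (i \<in> {1..n} \<longrightarrow> mu i \<in> {0..\<Sum>j\<in>{1..n}. lam j}) \<and> (i \<notin> {1..n} \<longrightarrow> mu i = 0)}"
  proof (intro subsetI CollectI allI conjI impI)
    fix mu i assume mu: "mu \<in> subcomps n lam"
    show "mu i \<in> {0..\<Sum>j\<in>{1..n}. lam j}" if "i \<in> {1..n}"
    proof -
      have "lam i \<le> (\<Sum>j\<in>{1..n}. lam j)" using that by (intro member_le_sum) auto
      then show ?thesis using mu that unfolding subcomps_def by (auto dest: spec[of _ i])
    qed
    show "mu i = 0" if "i \<notin> {1..n}" using mu that unfolding subcomps_def by (auto dest: spec[of _ i])
  qed
qed (intro finite_set_of_finite_funs; simp)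

lemma subcompsD: "mu \<in> subcomps n lam \<Longrightarrow> i \<in> {1..n} \<Longrightarrow> mu i \<le> lam i"
  unfolding subcomps_def by (auto dest: spec[of _ i])

text \<open>Multiplying out a Leibniz product chooses one summand \<open>m = mu i\<close> of
  \<open>Mat\<close> in every column \<open>i\<close>; these choices are the elements of
  \<open>subcomps\<close>.\<close>

lemma pdet_Mat: "(pdet {1..n} Mat :: 'a::field sym poly poly) = (\<Sum>mu\<in>subcomps n lam. \<Sum>p\<in>{p. p permutes {1..n}}.
    of_int (sign p) * monom (monom
      (\<Prod>i\<in>{1..n}. if mu i = 0 then (if p i = i then 1 else 0) else ev (p i, i, mu i - 1))
      (card {i\<in>{1..n}. mu i = 0})) (totN n lam - (\<Sum>i\<in>{1..n}. mu i)))"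
proof -
  let ?f = "\<lambda>p mu i. if mu i = 0 then (if p i = i then 1 else 0) else ev (p i, i, mu i - 1)"
  have *: "(\<Prod>i\<in>{1..n}. Mat (p i) i :: 'a sym poly poly) = (\<Sum>mu\<in>subcomps n lam. monom (monom (\<Prod>i\<in>{1..n}. ?f p mu i)
      (card {i\<in>{1..n}. mu i = 0})) (totN n lam - (\<Sum>i\<in>{1..n}. mu i)))" for p
  proof -
    have "(\<Prod>i\<in>{1..n}. Mat (p i) i :: 'a sym poly poly) = (\<Sum>g\<in>PiE {1..n} (\<lambda>i. {0..lam i}). \<Prod>i\<in>{1..n}.
       monom (monom (?f p g i) (if g i = 0 then 1 else 0)) (lam i - g i))"
      unfolding Mat_def by (subst prod_sum_PiE) auto
    also have "\<dots> = (\<Sum>mu\<in>subcomps n lam. \<Prod>i\<in>{1..n}.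
       monom (monom (?f p mu i) (if mu i = 0 then 1 else 0)) (lam i - mu i))"
      \<comment> \<open>Functions in \<open>PiE\<close> are \<open>undefined\<close> outside
        \<open>{1..n}\<close> while compositions are 0 there, so the bijection exchanges these
        default values.\<close>
      by (rule sum.reindex_bij_witness[of _ "\<lambda>mu. restrict mu {1..n}" "\<lambda>g i. if i \<in> {1..n} then g i else 0"])
         (auto simp: subcomps_def PiE_def extensional_def fun_eq_iff restrict_def Pi_def intro!: prod.cong split: if_splits)
    also have "\<dots> = (\<Sum>mu\<in>subcomps n lam. monom (monom (\<Prod>i\<in>{1..n}. ?f p mu i)
      (card {i\<in>{1..n}. mu i = 0})) (totN n lam - (\<Sum>i\<in>{1..n}. mu i)))"
    proof (rule sum.cong[OF refl])
      fix mu assume mu: "mu \<in> subcomps n lam"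
      have "(\<Sum>i\<in>{1..n}. lam i - mu i) = totN n lam - (\<Sum>i\<in>{1..n}. mu i)"
        unfolding totN_def by (rule sum_subtractf_nat) (use subcompsD[OF mu] in auto)
      moreover have "(\<Sum>i\<in>{1..n}. if mu i = 0 then 1 else 0) = card {i\<in>{1..n}. mu i = 0}"
        by (simp add: sum.If_cases Int_def)
      ultimately show "(\<Prod>i\<in>{1..n}. monom (monom (?f p mu i) (if mu i = 0 then 1 else 0)) (lam i - mu i)) =
         monom (monom (\<Prod>i\<in>{1..n}. ?f p mu i) (card {i\<in>{1..n}. mu i = 0})) (totN n lam - (\<Sum>i\<in>{1..n}. mu i))"
        by (simp only: prod_monom)
    qed
    finally show ?thesis .
  qed
  show ?thesis
    unfolding pdet_def * sum_distrib_left by (rule sum.swap)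
qed

text \<open>All \<open>n\<close> parts add up to N, so the \<open>LEAST\<close> is attained at most
  at \<open>n\<close>. Minimality gives the strict bound, and the empty sum excludes 0.\<close>

lemma dseq_bounds:
  assumes "r \<in> {1..totN n lam}"
  shows "1 \<le> dseq n lam r" "dseq n lam r \<le> n"
    "(\<Sum>k<dseq n lam r - 1. lam (n - k)) < r" "r \<le> (\<Sum>k<dseq n lam r. lam (n - k))"
proof -
  have n: "r \<le> (\<Sum>k<n. lam (n - k))"
  proof -
    have "(\<Sum>k<n. lam (n - k)) = totN n lam"
      unfolding totN_def by (rule sum.reindex_bij_witness[of _ "\<lambda>i. n - i" "\<lambda>k. n - k"]) auto
    then show ?thesis using assms by simp
  qed
  let ?P = "\<lambda>d. r \<le> (\<Sum>k<d. lam (n - k))"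
  show le: "dseq n lam r \<le> n" and P: "?P (dseq n lam r)"
    using n unfolding dseq_def by (auto intro: Least_le LeastI[of ?P])
  show 1: "1 \<le> dseq n lam r"
  proof (rule ccontr)
    assume "\<not> ?thesis"
    then have "dseq n lam r = 0" by simp
    then show False using P assms by simp
  qed
  have "\<not> ?P (dseq n lam r - 1)"
    using 1 not_less_Least[of "dseq n lam r - 1" ?P] unfolding dseq_def[symmetric] by simp
  then show "(\<Sum>k<dseq n lam r - 1. lam (n - k)) < r" by simp
qed

lemma sum_top_parts:
  assumes "d \<le> n"
  shows "(\<Sum>k<d. lam (n - k)) + (\<Sum>i\<in>{1..n - d}. lam i) = totN n lam"
proof -
  have "(\<Sum>k<d. lam (n - k)) = (\<Sum>i\<in>{n - d<..n}. lam i)"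
    by (rule sum.reindex_bij_witness[of _ "\<lambda>i. n - i" "\<lambda>k. n - k"]) (use assms in auto)
  moreover have "{1..n} = {n - d<..n} \<union> {1..n - d}" using assms by auto
  ultimately show ?thesis unfolding totN_def
    by (subst \<open>{1..n} = _\<close>, subst sum.union_disjoint) auto
qed

text \<open>For fixed \<open>mu\<close>, a permutation moving an index with \<open>mu i = 0\<close>
  picks a zero summand, so only permutations of the support of \<open>mu\<close> remain. The zeros
  of \<open>mu\<close> are counted by the exponent of y.\<close>

lemma xgen_coeff:
  assumes r: "r \<in> {1..totN n lam}"
  shows "(xgen n lam r :: 'a::field sym) = coeff (coeff (pdet {1..n} Mat) (totN n lam - r)) (n - dseq n lam r)"
proof -
  let ?f = "\<lambda>p mu i. if mu i = 0 then (if p i = i then 1 else 0) else (ev (p i, i, mu i - 1) :: 'a sym)"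
  let ?I = "\<lambda>mu. {i\<in>{1..n}. mu i \<noteq> (0::nat)}"
  let ?d = "dseq n lam r"
  have inner: "(\<Sum>p\<in>{p. p permutes {1..n}}. of_int (sign p) * (\<Prod>i\<in>{1..n}. ?f p mu i)) =
     (\<Sum>p\<in>{p. p permutes ?I mu}. of_int (sign p) * (\<Prod>i\<in>?I mu. ev (p i, i, mu i - 1)))" for mu
  proof -
    have "(\<Sum>p\<in>{p. p permutes {1..n}}. of_int (sign p) * (\<Prod>i\<in>{1..n}. ?f p mu i)) =
      (\<Sum>p\<in>{p. p permutes ?I mu}. of_int (sign p) * (\<Prod>i\<in>{1..n}. ?f p mu i))"
    proof (rule sum.mono_neutral_right)
      show "finite {p. p permutes {1..n}}" by (simp add: finite_permutations)
      show "{p. p permutes ?I mu} \<subseteq> {p. p permutes {1..n}}"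
        by (auto intro: permutes_subset)
      show "\<forall>p\<in>{p. p permutes {1..n}} - {p. p permutes ?I mu}. of_int (sign p) * (\<Prod>i\<in>{1..n}. ?f p mu i) = 0"
      proof
        fix p assume p: "p \<in> {p. p permutes {1..n}} - {p. p permutes ?I mu}"
        have "\<exists>i\<in>{1..n}. mu i = 0 \<and> p i \<noteq> i"
        proof (rule ccontr)
          assume "\<not> ?thesis"
          then have "\<And>x. x \<in> {1..n} - ?I mu \<Longrightarrow> p x = x" by fastforce
          then have "p permutes ?I mu"
            using p permutes_superset[of p "{1..n}" "?I mu"] by blast
          then show False using p by auto
        qed
        then obtain i where "i \<in> {1..n}" "?f p mu i = 0" by auto
        then have "(\<Prod>i\<in>{1..n}. ?f p mu i) = 0" by (intro prod_zero bexI[of _ i]) simp_all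
        then show "of_int (sign p) * (\<Prod>i\<in>{1..n}. ?f p mu i) = 0" by simp
      qed
    qed
    also have "\<dots> = (\<Sum>p\<in>{p. p permutes ?I mu}. of_int (sign p) * (\<Prod>i\<in>?I mu. ev (p i, i, mu i - 1)))"
    proof (rule sum.cong[OF refl])
      fix p assume "p \<in> {p. p permutes ?I mu}"
      then have fx: "p i = i" if "mu i = 0" for i using that by (auto simp: permutes_def)
      have "(\<Prod>i\<in>{1..n}. ?f p mu i) = (\<Prod>i\<in>?I mu. ?f p mu i)"
        by (rule prod.mono_neutral_right) (auto simp: fx)
      also have "\<dots> = (\<Prod>i\<in>?I mu. ev (p i, i, mu i - 1))" by (rule prod.cong) auto
      finally show "of_int (sign p) * (\<Prod>i\<in>{1..n}. ?f p mu i) =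
        of_int (sign p) * (\<Prod>i\<in>?I mu. ev (p i, i, mu i - 1))" by simp
    qed
    finally show ?thesis .
  qed
  have "coeff (coeff (pdet {1..n} Mat) (totN n lam - r)) (n - ?d) = (\<Sum>mu\<in>subcomps n lam.
     if (\<Sum>i\<in>{1..n}. mu i) = r \<and> card (?I mu) = ?d then
     (\<Sum>p\<in>{p. p permutes {1..n}}. of_int (sign p) * (\<Prod>i\<in>{1..n}. ?f p mu i)) else 0)"
    unfolding pdet_Mat coeff_sum coeff2_sign_mult
  proof (rule sum.cong[OF refl])
    fix mu assume mu: "mu \<in> subcomps n lam"
    have le: "(\<Sum>i\<in>{1..n}. mu i) \<le> totN n lam"
      unfolding totN_def by (rule sum_mono) (use subcompsD[OF mu] in auto)
    have "card (?I mu) + card {i\<in>{1..n}. mu i = 0} = card (?I mu \<union> {i\<in>{1..n}. mu i = 0})"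
      by (rule card_Un_disjoint[symmetric]) auto
    also have "?I mu \<union> {i\<in>{1..n}. mu i = 0} = {1..n}" by auto
    finally have "card (?I mu) + card {i\<in>{1..n}. mu i = 0} = n" by simp
    \<comment> \<open>The bounds \<open>dseq n lam r \<le> n\<close> here and
      \<open>r \<le> totN n lam\<close> below keep the truncated subtractions faithful.\<close>
    then have 1: "card {i\<in>{1..n}. mu i = 0} = n - ?d \<longleftrightarrow> card (?I mu) = ?d"
      using dseq_bounds(2)[OF r] by linarith
    have 2: "totN n lam - (\<Sum>i\<in>{1..n}. mu i) = totN n lam - r \<longleftrightarrow> (\<Sum>i\<in>{1..n}. mu i) = r"
      using le r by auto
    have 3: "coeff (coeff (monom (monom x (card {i\<in>{1..n}. mu i = 0})) (totN n lam - (\<Sum>i\<in>{1..n}. mu i))) (totN n lam - r)) (n - ?d)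
      = (if (\<Sum>i\<in>{1..n}. mu i) = r \<and> card (?I mu) = ?d then x else 0)" for x :: "'a sym"
      unfolding coeff_monom 2 1[symmetric] by (cases "(\<Sum>i\<in>{1..n}. mu i) = r") simp_all
    show "(\<Sum>p\<in>{p. p permutes {1..n}}. of_int (sign p) * coeff (coeff (monom (monom
      (\<Prod>i\<in>{1..n}. ?f p mu i) (card {i\<in>{1..n}. mu i = 0})) (totN n lam - (\<Sum>i\<in>{1..n}. mu i))) (totN n lam - r)) (n - ?d)) =
      (if (\<Sum>i\<in>{1..n}. mu i) = r \<and> card (?I mu) = ?d then
       (\<Sum>p\<in>{p. p permutes {1..n}}. of_int (sign p) * (\<Prod>i\<in>{1..n}. ?f p mu i)) else 0)"
      unfolding 3 by (cases "(\<Sum>i\<in>{1..n}. mu i) = r \<and> card (?I mu) = ?d") (simp_all only: simp_thms if_True if_False mult_zero_right sum.neutral_const)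
  qed
  also have "\<dots> = xgen n lam r"
    unfolding xgen_def inner using finite_subcomps
    by (simp add: sum.inter_filter[symmetric])
  finally show ?thesis ..
qed

text \<open>Since \<open>r\<close> exceeds the sum of the d - 1 largest parts, N - r is below the
  sum of the n - d + 1 smallest ones. This is the range of \<open>adS_coeff_pdet\<close> with
  \<open>a = n - d\<close>.\<close>

lemma xgen_InvS:
  assumes r: "r \<in> {1..totN n lam}"
  shows "(xgen n lam r :: 'a::field_char_0 sym) \<in> InvS n lam"
  unfolding InvS_def Sge_iff
proof (intro CollectI conjI ballI)
  show "in_vars (gbasis n lam) (xgen n lam r)"
    unfolding xgen_def by (intro in_vars_sum in_vars_mult in_vars_of_int in_vars_prod in_vars_ev)
  fix b assume b: "b \<in> gbasis n lam"
  obtain k l s where kls: "b = (k, l, s)" by (metis prod_cases3)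
  let ?d = "dseq n lam r"
  note d = dseq_bounds[OF r]
  have "n - (?d - 1) = n - ?d + 1" using d by simp
  then have "totN n lam = (\<Sum>k<?d - 1. lam (n - k)) + (\<Sum>i\<in>{1..n - ?d + 1}. lam i)"
    using sum_top_parts[of "?d - 1"] d by simp
  then have "totN n lam - r < (\<Sum>i\<in>{1..n - ?d + 1}. lam i)" using d(3) r unfolding atLeastAtMost_iff by linarith
  then show "adS n lam b (xgen n lam r :: 'a sym) = 0"
    unfolding xgen_coeff[OF r] kls by (rule adS_coeff_pdet[OF b[unfolded kls]])
qed

end

section \<open>Restriction to the slice\<close>

lemma pdv_not_in_vars:
  assumes "in_vars B p" "c \<notin> B"
  shows "pdv c p = 0"
proof (rule poly_mapping_eqI)
  fix m
  have "m + Poly_Mapping.single c 1 \<notin> Poly_Mapping.keys p"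
  proof
    assume k: "m + Poly_Mapping.single c 1 \<in> Poly_Mapping.keys p"
    have "c \<in> Poly_Mapping.keys (m + Poly_Mapping.single c 1)" by (simp add: in_keys_iff lookup_add)
    then show False using k assms by (auto simp: in_vars_def)
  qed
  then show "Poly_Mapping.lookup (pdv c p) m = Poly_Mapping.lookup 0 m"
    by (simp add: lookup_pdv in_keys_iff)
qed

lemma in_vars_mev:
  assumes "\<And>c. c \<in> A \<Longrightarrow> in_vars B (f c)" "\<And>x. in_vars B (h x)" "in_vars A p"
  shows "in_vars B (mev h f p)"
  unfolding mev_def
  by (intro in_vars_sum in_vars_mult in_vars_prod in_vars_power assms)
     (use assms(3) in \<open>auto simp: in_vars_def\<close>)

context sorted_composition
begin

text \<open>The values stay in the same polynomial ring, so restriction to the slice becomes an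
  idempotent endomorphism that can be combined with \<open>pdv\<close>.\<close>

definition slice_val :: "nat \<times> nat \<times> nat \<Rightarrow> 'a::field sym" where
  "slice_val = (\<lambda>(i, j, r). if i < n then (if j = i + 1 \<and> r = lam j - 1 then 1 else 0) else PVar (i, j, r))"

definition rho :: "'a::field sym \<Rightarrow> 'a sym" where
  "rho = mev PConst slice_val"

lemma rho_morph: "ring_morph rho"
  unfolding rho_def by (rule mev_morph[OF PConst_morph])

lemmas rho_simps [simp] = ring_morphD[OF rho_morph]

lemma rho_PConst [simp]: "rho (PConst c) = PConst c"
  by (simp add: rho_def PConst_morph)

lemma rho_PVar: "rho (PVar c) = slice_val c"
  by (simp add: rho_def PConst_morph)

lemma rho_rho [simp]: "rho (rho p) = rho p"
proof (induction p rule: sym_induct)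
  case (var b)
  show ?case by (cases b) (auto simp: rho_PVar slice_val_def)
qed auto

text \<open>The coordinates with first index at least \<open>n\<close> are tangential:
  \<open>slice_val\<close> fixes them and sends all others to constants.\<close>

lemma rho_pdv:
  assumes "n \<le> fst t"
  shows "rho (pdv t q) = pdv t (rho q)"
proof (induction q rule: sym_induct)
  case (var b)
  have "pdv t 1 = 0" using pdv_PConst[of t 1] by (simp add: ring_morph_1[OF PConst_morph])
  then show ?case using assms
    by (cases b) (auto simp: rho_PVar slice_val_def pdv_PVar)
qed (auto simp: pdv_add pdv_mult)

text \<open>Positivity of the parts puts \<open>(i, i + 1, lam (i + 1) - 1)\<close> into the basis.
  Off the basis \<open>ev\<close> is 0, so the formula covers all \<open>j\<close> and
  \<open>r\<close>.\<close>

lemma rho_ev: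
  assumes "1 \<le> i" "i < n"
  shows "rho (ev (i, j, r)) = (if j = i + 1 \<and> r = lam j - 1 then 1 else 0)"
proof (cases "j = i + 1 \<and> r = lam j - 1")
  case True
  then have "0 < lam i" "0 < lam j" using pos assms by auto
  then have "(i, j, r) \<in> gbasis n lam" using True assms by (auto simp: gbasis_iff)
  then show ?thesis using True assms by (simp add: evar_def rho_PVar slice_val_def)
next
  case False
  then show ?thesis using assms by (auto simp: evar_def rho_PVar slice_val_def)
qed

text \<open>\<^term>\<open>V k q\<close> says that \<^term>\<open>q\<close> vanishes to order \<open>k + 1\<close> along the slice, i.e. that it
  lies in the \<open>(k + 1)\<close>-st power of the ideal of the slice; the coordinates \<open>(i, j, r)\<close> with
  \<open>i < n\<close> are the ones transverse to it.\<close>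

primrec V :: "nat \<Rightarrow> 'a::field sym \<Rightarrow> bool" where
  "V 0 q \<longleftrightarrow> rho q = 0"
| "V (Suc k) q \<longleftrightarrow> rho q = 0 \<and> (\<forall>c. fst c < n \<longrightarrow> V k (pdv c q))"

lemma V_SucD: "V (Suc k) q \<Longrightarrow> fst c < n \<Longrightarrow> V k (pdv c q)"
  by (cases c) simp

lemma V_SucI: "rho q = 0 \<Longrightarrow> (\<And>c. fst c < n \<Longrightarrow> V k (pdv c q)) \<Longrightarrow> V (Suc k) q"
  by simp

lemma V_0: "V k 0"
  by (induction k) auto

lemma V_add: "V k p \<Longrightarrow> V k q \<Longrightarrow> V k (p + q)"
  by (induction k arbitrary: p q) (auto simp: pdv_add)

lemma V_uminus: "V k p \<Longrightarrow> V k (- p)"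
  by (induction k arbitrary: p) (auto simp: pdv_uminus)

lemma V_sum: "(\<And>i. i \<in> A \<Longrightarrow> V k (f i)) \<Longrightarrow> V k (sum f A)"
  by (induction A rule: infinite_finite_induct) (auto intro: V_0 V_add)

lemma V_Suc_imp: "V (Suc k) q \<Longrightarrow> V k q"
  by (induction k arbitrary: q) auto

lemma V_mult: "V k q \<Longrightarrow> V k (f * q)"
proof (induction k arbitrary: f q)
  case (Suc k)
  note q = V_Suc_imp[OF Suc.prems]
  show ?case using Suc q by (auto simp: pdv_mult intro!: V_add)
qed simp

text \<open>Of the two terms of the product rule, one keeps the factor \<open>f\<close> that
  vanishes on the slice, and the other keeps \<open>q\<close> at its full order.\<close>

lemma V_mult_rho: "rho f = 0 \<Longrightarrow> V k q \<Longrightarrow> V (Suc k) (f * q)"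
proof (induction k arbitrary: q)
  case 0
  then show ?case by (auto simp: pdv_mult)
next
  case (Suc k)
  have star: "V (Suc k) (pdv c (f * q))" if c: "fst c < n" for c
  proof -
    have "V (Suc k) (f * pdv c q)" by (rule Suc.IH[OF Suc.prems(1) V_SucD[OF Suc.prems(2) c]])
    moreover have "V (Suc k) (pdv c f * q)" using Suc.prems V_mult by blast
    ultimately show ?thesis unfolding pdv_mult by (rule V_add)
  qed
  show ?case
  proof (rule V_SucI)
    show "rho (f * q) = 0" using Suc.prems by simp
  qed (rule star)
qed

text \<open>Tangential derivatives commute with restriction and with the transverse derivatives, so
  they do not lower the order.\<close>

lemma V_tangential: "n \<le> fst t \<Longrightarrow> V k q \<Longrightarrow> V k (pdv t q)"
  by (induction k arbitrary: q) (auto simp: rho_pdv pdv_commute[of _ t])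

text \<open>Reads \<open>adS n lam b p = 0\<close> modulo \<open>V k\<close>. Tangential derivatives
  are negligible, and the difference between \<open>brk b c\<close> and its restriction vanishes on
  the slice, which makes up for the order lost by a transverse derivative. What remains is a linear
  system with coefficients \<open>rho (brk b c)\<close>.\<close>

lemma V_invariant:
  assumes p: "adS n lam b p = 0" and b: "b \<in> gbasis n lam" and V: "V k p"
  shows "V k (\<Sum>c\<in>{c\<in>gbasis n lam. fst c < n}. pdv c p * rho (brk b c))"
proof -
  let ?G = "gbasis n lam"
  let ?h = "\<lambda>c. if fst c < n then pdv c p * rho (brk b c) else 0"
  have "V k (pdv c p * brk b c - ?h c)" for c
  proof (cases "fst c < n")
    case False
    then have "V k (pdv c p)" by (intro V_tangential V) simp
    then show ?thesis using False V_mult[of k "pdv c p" "brk b c"] by (simp add: mult.commute)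
  next
    case True
    have r: "rho (brk b c - rho (brk b c)) = 0" by simp
    have "V k ((brk b c - rho (brk b c)) * pdv c p)"
    proof (cases k)
      case 0
      then show ?thesis by simp
    next
      case (Suc k')
      show ?thesis
        unfolding Suc by (rule V_mult_rho[OF r V_SucD[OF V[unfolded Suc] True]])
    qed
    then show ?thesis using True by (simp add: algebra_simps)
  qed
  then have "V k (\<Sum>c\<in>?G. pdv c p * brk b c - ?h c)" by (intro V_sum)
  also have "(\<Sum>c\<in>?G. pdv c p * brk b c - ?h c) = - (\<Sum>c\<in>?G. ?h c)"
    using p b by (simp add: sum_subtractf adS_brk)
  finally have "V k (\<Sum>c\<in>?G. ?h c)" using V_uminus by fastforce
  then show ?thesis by (simp add: sum.inter_filter)
qed

text \<open>The rows \<^term>\<open>b\<close> chosen here make the matrix of constants \<^term>\<open>rho (brk b c)\<close> triangular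
  in the first index of \<^term>\<open>c\<close>.\<close>

lemma V_pdv_triangular:
  fixes p :: "'a::field sym"
  assumes p: "p \<in> InvS n lam" and V: "V k p"
    and b: "b \<in> gbasis n lam" and c: "c \<in> gbasis n lam" "fst c < n"
    and unit: "rho (brk b c) = (1 :: 'a sym) \<or> rho (brk b c) = (- 1 :: 'a sym)"
    and other: "\<And>c'. c' \<in> gbasis n lam \<Longrightarrow> fst c' < n \<Longrightarrow> c' \<noteq> c \<Longrightarrow>
      rho (brk b c') = (0 :: 'a sym) \<or> V k (pdv c' p)"
  shows "V k (pdv c p)"
proof -
  let ?A = "{c\<in>gbasis n lam. fst c < n}"
  have f: "finite ?A" by simp
  have cA: "c \<in> ?A" using c by simp
  have "adS n lam b p = 0" using p b by (simp add: InvS_def)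
  then have 1: "V k (\<Sum>c\<in>?A. pdv c p * rho (brk b c))" using V_invariant b V by blast
  have 2: "V k (\<Sum>c\<in>?A - {c}. pdv c p * rho (brk b c))"
  proof (rule V_sum)
    fix c' assume "c' \<in> ?A - {c}"
    then have "rho (brk b c') = (0 :: 'a sym) \<or> V k (pdv c' p)" using other by auto
    then show "V k (pdv c' p * rho (brk b c'))"
      using V_mult[of k "pdv c' p" "rho (brk b c')"] V_0[of k] by (auto simp: mult.commute)
  qed
  have "pdv c p * rho (brk b c) =
      (\<Sum>c\<in>?A. pdv c p * rho (brk b c)) + - (\<Sum>c\<in>?A - {c}. pdv c p * rho (brk b c))"
    by (subst sum.remove[OF f cA]) simp
  then have "V k (pdv c p * rho (brk b c))"
    using V_add[OF 1 V_uminus[OF 2]] by simp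
  then show ?thesis using unit V_uminus[of k "- pdv c p"] by auto
qed

text \<open>The row \<open>b = (j, i + 1, s)\<close> is chosen so that its bracket with e_{i,j;r}
  contains -e_{i,i+1} with the top exponent, which is -1 on the slice. Other nonzero coefficients
  occur only at positions \<open>(i + 1, j + 1)\<close>, so the induction descends in
  \<open>i\<close>.\<close>

lemma V_pdv_low:
  fixes p :: "'a::field sym"
  assumes p: "p \<in> InvS n lam" and V: "V k p"
  shows "(i, j, r) \<in> gbasis n lam \<Longrightarrow> j \<le> i \<Longrightarrow> i < n \<Longrightarrow> V k (pdv (i, j, r) p)"
proof (induction "n - i" arbitrary: i j r rule: less_induct)
  case less
  note g = less.prems(1)[unfolded gbasis_iff]
  define s where "s = lam (i + 1) - 1 - r"
  have le: "lam i \<le> lam (i + 1)" "lam j \<le> lam (i + 1)" using sorted g less.prems by auto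
  have rs: "r + s = lam (i + 1) - 1" "r < lam (i + 1)" using g le by (auto simp: s_def)
  have b: "(j, i + 1, s) \<in> gbasis n lam" using g less.prems le by (auto simp: gbasis_iff s_def)
  show ?case
  proof (rule V_pdv_triangular[OF p V b less.prems(1)])
    show "fst (i, j, r) < n" using less.prems by simp
    show "rho (brk (j, i + 1, s) (i, j, r)) = (1 :: 'a sym) \<or> rho (brk (j, i + 1, s) (i, j, r)) = (- 1 :: 'a sym)"
      using rs g less.prems by (simp add: brk_def rho_ev add.commute)
    fix c' assume c': "c' \<in> gbasis n lam" "fst c' < n" "c' \<noteq> (i, j, r)"
    obtain i' j' r' where e: "c' = (i', j', r')" by (metis prod_cases3)
    note g' = c'(1)[unfolded e gbasis_iff]
    show "rho (brk (j, i + 1, s) c') = (0 :: 'a sym) \<or> V k (pdv c' p)"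
    proof (cases "i' = i + 1 \<and> j' = j + 1")
      case True
      then show ?thesis using less.hyps[of i' j' r'] c' less.prems e by auto
    next
      case False
      have "\<not> (j = j' \<and> i' = i \<and> s + r' = lam (i + 1) - 1)" using c' rs e by auto
      then have "rho (brk (j, i + 1, s) c') = (0 :: 'a sym)"
        using False c' g' g less.prems by (auto simp: e brk_def rho_ev)
      then show ?thesis ..
    qed
  qed
qed

text \<open>Here \<open>b = (j - 1, i, s)\<close> produces e_{j-1,j} with the top exponent, which is
  1 on the slice. Other nonzero coefficients occur only at \<open>(i - 1, j - 1)\<close>, so the
  induction ascends in \<open>i\<close>.\<close>

lemma V_pdv_high:
  fixes p :: "'a::field sym"
  assumes p: "p \<in> InvS n lam" and V: "V k p"
  shows "(i, j, r) \<in> gbasis n lam \<Longrightarrow> i < j \<Longrightarrow> V k (pdv (i, j, r) p)"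
proof (induction i arbitrary: j r rule: less_induct)
  case (less i)
  note g = less.prems(1)[unfolded gbasis_iff]
  define s where "s = lam j - 1 - r"
  \<comment> \<open>This is what places \<open>b\<close> in the basis; it rests on
    \<open>i \<le> j - 1\<close>.\<close>
  have le: "lam i \<le> lam (j - 1)" using sorted[rule_format, of i "j - 1"] g less.prems by auto
  have rs: "r + s = lam j - 1" using g by (auto simp: s_def)
  have b: "(j - 1, i, s) \<in> gbasis n lam" using g less.prems le by (auto simp: gbasis_iff s_def)
  show ?case
  proof (rule V_pdv_triangular[OF p V b less.prems(1)])
    show "fst (i, j, r) < n" using g less.prems by simp
    show "rho (brk (j - 1, i, s) (i, j, r)) = (1 :: 'a sym) \<or> rho (brk (j - 1, i, s) (i, j, r)) = (- 1 :: 'a sym)"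
      using rs g less.prems by (auto simp add: brk_def rho_ev add.commute)
    fix c' assume c': "c' \<in> gbasis n lam" "fst c' < n" "c' \<noteq> (i, j, r)"
    obtain i' j' r' where e: "c' = (i', j', r')" by (metis prod_cases3)
    note g' = c'(1)[unfolded e gbasis_iff]
    show "rho (brk (j - 1, i, s) c') = (0 :: 'a sym) \<or> V k (pdv c' p)"
    proof (cases "i = i' + 1 \<and> j' = j - 1")
      case True
      then show ?thesis using less.IH[of i' j' r'] c' less.prems e by auto
    next
      case False
      have ne: "\<not> (j = j' \<and> i' = i \<and> s + r' = lam j - 1)" using c' rs g e by auto
      have "rho (ev (j - 1, j', s + r')) = (if j = j' \<and> s + r' = lam j - 1 then 1 else (0 :: 'a sym))"
        using g less.prems by (subst rho_ev) auto
      moreover have "rho (ev (i', i, s + r')) = (if i = i' + 1 \<and> s + r' = lam i - 1 then 1 else (0 :: 'a sym))"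
        using g' c' e by (subst rho_ev) auto
      ultimately have "rho (brk (j - 1, i, s) c') = (0 :: 'a sym)"
        using False ne by (auto simp: e brk_def)
      then show ?thesis ..
    qed
  qed
qed

text \<open>The two triangular cases cover all transverse variables of the basis; any other variable
  does not occur in \<open>p\<close>.\<close>

lemma V_step:
  assumes p: "p \<in> InvS n lam" and V: "V k p"
  shows "V (Suc k) p"
proof -
  have "V k (pdv c p)" if "fst c < n" for c
  proof (cases "c \<in> gbasis n lam")
    case True
    obtain i j r where c: "c = (i, j, r)" by (metis prod_cases3)
    have "(i, j, r) \<in> gbasis n lam" "i < n" using True that c by auto
    then show ?thesis
      using V_pdv_low[OF p V] V_pdv_high[OF p V] unfolding c by (cases "j \<le> i") (blast, auto)
  next
    case False
    then have "pdv c p = 0" using p by (intro pdv_not_in_vars) (auto simp: InvS_def Sge_iff)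
    then show ?thesis by (simp add: V_0)
  qed
  moreover have "rho p = 0" using V by (cases k) auto
  ultimately show ?thesis by (intro V_SucI) simp_all
qed

text \<open>In characteristic zero no transverse variable can occur in \<open>p\<close>, so
  \<open>rho\<close> fixes \<open>p\<close>.\<close>

lemma transverse_pdv_zero_imp_zero:
  fixes p :: "'a::field_char_0 sym"
  assumes d: "\<And>c. fst c < n \<Longrightarrow> pdv c p = 0" and 0: "rho p = 0"
  shows "p = 0"
proof -
  have "rho p = p"
  proof (rule ring_morph_eqI[OF rho_morph ring_morph_id, where B = "{c. n \<le> fst c}"])
    show "rho (Poly_Mapping.single 0 c) = Poly_Mapping.single 0 c" for c :: 'a
      using rho_PConst[of c] by (simp add: PConst_def)
    show "rho (Poly_Mapping.single (Poly_Mapping.single b 1) 1) = (Poly_Mapping.single (Poly_Mapping.single b 1) 1 :: 'a sym)"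
      if "b \<in> {c. n \<le> fst c}" for b
      using that rho_PVar[of b] by (cases b) (auto simp: PVar_def slice_val_def)
    show "\<forall>m\<in>Poly_Mapping.keys p. Poly_Mapping.keys m \<subseteq> {c. n \<le> fst c}"
    proof (intro ballI subsetI CollectI)
      fix m c assume "m \<in> Poly_Mapping.keys p" "c \<in> Poly_Mapping.keys m"
      then have "pdv c p \<noteq> 0" using pdv_zero_not_in_vars by blast
      then show "n \<le> fst c" using d[of c] by linarith
    qed
  qed
  then show ?thesis using 0 by simp
qed

text \<open>Transverse derivatives have smaller degree and inherit vanishing to all orders, so they
  are zero by induction.\<close>

lemma V_all_zero:
  fixes p :: "'a::field_char_0 sym"
  shows "mdeg_le d p \<Longrightarrow> (\<And>k. V k p) \<Longrightarrow> p = 0"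
proof (induction d arbitrary: p)
  case 0
  show ?case
    by (rule transverse_pdv_zero_imp_zero) (use mdeg_le_0_pdv[OF 0(1)] 0(2)[of 0] in simp_all)
next
  case (Suc d)
  have h: "pdv c p = 0" if "fst c < n" for c
    using Suc.IH[OF mdeg_le_pdv[OF Suc.prems(1)]] V_SucD[OF Suc.prems(2) that] by blast
  show ?case
    by (rule transverse_pdv_zero_imp_zero[OF h]) (use Suc.prems(2)[of 0] in simp_all)
qed

text \<open>Starting from \<open>V 0 p\<close>, repeated use of \<open>V_step\<close> raises the
  order of vanishing without bound.\<close>

lemma rho_inj_InvS:
  fixes p :: "'a::field_char_0 sym"
  assumes p: "p \<in> InvS n lam" and 0: "rho p = 0"
  shows "p = 0"
proof -
  obtain d where "mdeg_le d p" using mdeg_le_exists by blast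
  moreover have "V k p" for k
    by (induction k) (use 0 V_step[OF p] in auto)
  ultimately show ?thesis by (rule V_all_zero)
qed

end

section \<open>The generators on the slice\<close>

context sorted_composition
begin

abbreviation topsum :: "nat \<Rightarrow> nat" where "topsum d \<equiv> \<Sum>k<d. lam (n - k)"

text \<open>The variable to which \<open>xgen n lam r\<close> restricts up to sign: the d - 1
  largest parts are taken in full, the remainder of \<open>r\<close> sits in column n + 1 - d, and
  the last \<open>- 1\<close> turns that part into an exponent.\<close>

definition slice_coord :: "nat \<Rightarrow> nat \<times> nat \<times> nat" where
  "slice_coord r = (n, n + 1 - dseq n lam r, r - topsum (dseq n lam r - 1) - 1)"

text \<open>The cycle on \<open>{j..n}\<close> whose term survives in the determinant of a companion
  matrix.\<close>

definition slice_cycle :: "nat \<Rightarrow> nat \<Rightarrow> nat" where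
  "slice_cycle j i = (if i = j then n else if j < i \<and> i \<le> n then i - 1 else i)"

lemma slice_cycle_permutes:
  assumes "1 \<le> j" "j \<le> n"
  shows "slice_cycle j permutes {j..n}"
proof (rule bij_imp_permutes)
  show "bij_betw (slice_cycle j) {j..n} {j..n}"
    by (rule bij_betw_byWitness[where f' = "\<lambda>i. if i = n then j else i + 1"])
       (use assms in \<open>auto simp: slice_cycle_def\<close>)
  show "x \<notin> {j..n} \<Longrightarrow> slice_cycle j x = x" for x
    using assms by (auto simp: slice_cycle_def)
qed

text \<open>The least index of \<open>I\<close> cannot step down inside \<open>I\<close>, so it goes
  to \<open>n\<close>. By injectivity all others step down, and descending from \<open>n\<close>
  fills the interval.\<close>

lemma support_is_interval:
  assumes I: "I \<subseteq> {1..n}" "I \<noteq> {}" and p: "p permutes I"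
    and step: "\<And>i. i \<in> I \<Longrightarrow> p i \<noteq> n \<Longrightarrow> i = p i + 1"
  defines "j \<equiv> n + 1 - card I"
  shows "I = {j..n} \<and> 1 \<le> j \<and> j \<le> n \<and> p = slice_cycle j"
proof -
  have fI: "finite I" using I(1) finite_subset by blast
  define m where "m = Min I"
  have m: "m \<in> I" "\<And>i. i \<in> I \<Longrightarrow> m \<le> i" using fI I(2) by (auto simp: m_def)
  have pI: "p i \<in> I" if "i \<in> I" for i using p that by (simp add: permutes_in_image)
  have pm: "p m = n"
  proof (rule ccontr)
    assume "p m \<noteq> n"
    then have "m = p m + 1" using step m by blast
    then show False using m(2)[OF pI[OF m(1)]] by simp
  qed
  have nI: "n \<in> I" using pI[OF m(1)] pm by simp
  have pi: "i = p i + 1" if "i \<in> I" "i \<noteq> m" for i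
    using step that pm permutes_inj[OF p] by (metis injD)
  have "x \<in> I" if "m \<le> x" "x \<le> n" for x
    using that(2)
  proof (induction rule: inc_induct)
    case (step x')
    then have "Suc x' = p (Suc x') + 1" using pi that by auto
    then show ?case using pI[OF step.IH] by simp
  qed (rule nI)
  then have Ie: "I = {m..n}" using m I(1) by auto
  have mn: "1 \<le> m" "m \<le> n" using m I(1) by auto
  have jm: "j = m" using mn by (simp add: j_def Ie)
  have "p = slice_cycle m"
  proof
    fix i
    consider "i = m" | "m < i" "i \<le> n" | "i \<notin> I" using Ie by fastforce
    then show "p i = slice_cycle m i"
    proof cases
      case 1
      then show ?thesis by (simp add: slice_cycle_def pm)
    next
      case 2
      then have "i = p i + 1" using pi Ie by simp
      then show ?thesis using 2 by (simp add: slice_cycle_def)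
    next
      case 3
      then show ?thesis using p Ie mn by (auto simp: slice_cycle_def permutes_def)
    qed
  qed
  then show ?thesis using jm Ie mn by simp
qed

lemma topsum_eq: "d \<le> n \<Longrightarrow> topsum d = (\<Sum>i\<in>{n + 1 - d..n}. lam i)"
  by (rule sum.reindex_bij_witness[of _ "\<lambda>i. n - i" "\<lambda>k. n - k"]) auto

text \<open>On the slice a factor with \<open>p i < n\<close> survives only if
  \<open>i = p i + 1\<close> and \<open>mu i = lam i\<close>. So \<open>p\<close> is the cycle of
  \<open>support_is_interval\<close>, all parts after \<open>j\<close> are full, and the total
  \<open>r\<close> fixes the part at \<open>j\<close>: one term remains.\<close>

lemma rho_xgen:
  assumes r: "r \<in> {1..totN n lam}"
  shows "\<exists>s\<in>{1, -1}. rho (xgen n lam r) = of_int s * (PVar (slice_coord r) :: 'a::field sym)"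
proof -
  define d where "d = dseq n lam r"
  define j where "j = n + 1 - d"
  define t where "t = r - topsum (d - 1)"
  let ?I = "\<lambda>mu. {i\<in>{1..n}. mu i \<noteq> (0::nat)}"
  define mu0 where "mu0 i = (if i = j then t else if j < i \<and> i \<le> n then lam i else 0)" for i
  let ?p0 = "slice_cycle j"
  let ?T = "\<lambda>mu p. of_int (sign p) * (\<Prod>i\<in>?I mu. rho (ev (p i, i, mu i - 1) :: 'a sym))"
  define A where "A = {mu \<in> subcomps n lam. (\<Sum>i\<in>{1..n}. mu i) = r \<and> card (?I mu) = d}"
  note dn = dseq_bounds[OF r, folded d_def]
  have j: "1 \<le> j" "j \<le> n" "n + 1 - j = d" "n + 1 - (d - 1) = j + 1" "n - (d - 1) = j"
    using dn by (auto simp: j_def)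
  have "topsum d = topsum (d - 1) + lam (n - (d - 1))"
    using dn(1) by (cases d) auto
  then have t: "1 \<le> t" "t \<le> lam j" "r = topsum (d - 1) + t" using dn j by (auto simp: t_def)
  have top: "topsum (d - 1) = (\<Sum>i\<in>{j + 1..n}. lam i)"
    using topsum_eq[of "d - 1"] dn j by simp
  have lampos: "0 < lam i" if "1 \<le> i" "i \<le> n" for i using pos that by auto
  have I0: "?I mu0 = {j..n}" using j t lampos by (auto simp: mu0_def)
  have split: "{j..n} = insert j {j + 1..n}" using j by auto
  have uniq: "mu = mu0 \<and> p = ?p0" if mu: "mu \<in> A" and p: "p permutes ?I mu" and nz: "?T mu p \<noteq> 0" for mu p
  proof -
    have I: "?I mu \<subseteq> {1..n}" "card (?I mu) = d" using mu by (auto simp: A_def)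
    have I1: "?I mu \<noteq> {}" using I dn by (metis card.empty not_one_le_zero)
    have fac: "i = p i + 1 \<and> mu i = lam i" if i: "i \<in> ?I mu" and pn: "p i \<noteq> n" for i
    proof -
      have pi: "p i \<in> ?I mu" using permutes_in_image[OF p] i by blast
      then have pr: "1 \<le> p i" "p i < n" using pn by auto
      have "(\<Prod>i\<in>?I mu. rho (ev (p i, i, mu i - 1) :: 'a sym)) \<noteq> 0" using nz by auto
      then have "rho (ev (p i, i, mu i - 1) :: 'a sym) \<noteq> 0"
        using i prod_zero[of "?I mu" "\<lambda>i. rho (ev (p i, i, mu i - 1) :: 'a sym)"] by auto
      then have "i = p i + 1" "mu i - 1 = lam i - 1"
        unfolding rho_ev[OF pr] by (auto split: if_splits)
      then show ?thesis using i lampos[of i] by auto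
    qed
    have S: "?I mu = {j..n} \<and> 1 \<le> j \<and> j \<le> n \<and> p = ?p0"
      using support_is_interval[OF I(1) I1 p conjunct1[OF fac]] unfolding I(2) j_def by blast
    have mul: "mu i = lam i" if "j < i" "i \<le> n" for i
    proof -
      have "i \<in> ?I mu" using S that by auto
      moreover have "p i \<noteq> n" using S that by (auto simp: slice_cycle_def)
      ultimately show ?thesis using fac by blast
    qed
    have "r = (\<Sum>i\<in>{1..n}. mu i)" using mu by (simp add: A_def)
    also have "\<dots> = (\<Sum>i\<in>?I mu. mu i)" by (rule sum.mono_neutral_right) auto
    also have "\<dots> = mu j + (\<Sum>i\<in>{j + 1..n}. mu i)" using S by (simp only: split) simp
    also have "(\<Sum>i\<in>{j + 1..n}. mu i) = topsum (d - 1)" unfolding top by (rule sum.cong) (auto simp: mul)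
    finally have muj: "mu j = t" using t(3) by simp
    have out: "mu i = 0" if "\<not> (j \<le> i \<and> i \<le> n)" for i
    proof (cases "i \<in> {1..n}")
      case True
      then show ?thesis using S that by auto
    next
      case False
      then show ?thesis using mu unfolding A_def subcomps_def by (auto dest: spec[of _ i])
    qed
    have "mu = mu0"
      using mul muj out by (auto simp: mu0_def fun_eq_iff)
    then show ?thesis using S by simp
  qed
  have mu0A: "mu0 \<in> A"
  proof -
    have "mu0 \<in> subcomps n lam" using t j by (auto simp: subcomps_def mu0_def)
    moreover have "(\<Sum>i\<in>{1..n}. mu0 i) = r"
    proof -
      have "(\<Sum>i\<in>{1..n}. mu0 i) = (\<Sum>i\<in>{j..n}. mu0 i)"
        by (rule sum.mono_neutral_right) (use j in \<open>auto simp: mu0_def\<close>)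
      also have "\<dots> = mu0 j + (\<Sum>i\<in>{j + 1..n}. mu0 i)" by (simp add: split)
      also have "(\<Sum>i\<in>{j + 1..n}. mu0 i) = topsum (d - 1)"
        unfolding top by (rule sum.cong) (auto simp: mu0_def)
      finally show ?thesis using t(3) by (simp add: mu0_def)
    qed
    moreover have "card (?I mu0) = d" unfolding I0 using j by simp
    ultimately show ?thesis by (simp add: A_def)
  qed
  have p0: "?p0 permutes ?I mu0" unfolding I0 by (rule slice_cycle_permutes[OF j(1,2)])
  have fA: "finite A" unfolding A_def using finite_subcomps by simp
  have fp: "finite {p. p permutes ?I mu}" for mu :: "nat \<Rightarrow> nat" by (simp add: finite_permutations)
  have "rho (xgen n lam r) = (\<Sum>mu\<in>A. \<Sum>p\<in>{p. p permutes ?I mu}. ?T mu p)"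
    unfolding xgen_def A_def d_def
    by (simp add: ring_morph_sum[OF rho_morph] ring_morph_prod[OF rho_morph] ring_morph_of_int[OF rho_morph])
  also have "\<dots> = (\<Sum>(mu, p)\<in>Sigma A (\<lambda>mu. {p. p permutes ?I mu}). ?T mu p)"
    by (rule sum.Sigma) (use fA fp in auto)
  also have "\<dots> = (\<Sum>(mu, p)\<in>{(mu0, ?p0)}. ?T mu p)"
  proof (rule sum.mono_neutral_right)
    show "finite (Sigma A (\<lambda>mu. {p. p permutes ?I mu}))" by (intro finite_SigmaI fA fp)
    show "{(mu0, ?p0)} \<subseteq> Sigma A (\<lambda>mu. {p. p permutes ?I mu})" using mu0A p0 by blast
    show "\<forall>x\<in>Sigma A (\<lambda>mu. {p. p permutes ?I mu}) - {(mu0, ?p0)}. (case x of (mu, p) \<Rightarrow> ?T mu p) = 0"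
    proof
      fix x assume x: "x \<in> Sigma A (\<lambda>mu. {p. p permutes ?I mu}) - {(mu0, ?p0)}"
      obtain mu p where e: "x = (mu, p)" by (cases x)
      have "mu \<in> A" "p permutes ?I mu" "\<not> (mu = mu0 \<and> p = ?p0)" using x unfolding e by blast+
      then have "?T mu p = 0" using uniq by blast
      then show "(case x of (mu, p) \<Rightarrow> ?T mu p) = 0" by (simp only: e prod.case)
    qed
  qed
  also have "\<dots> = ?T mu0 ?p0" by simp
  also have "(\<Prod>i\<in>?I mu0. rho (ev (?p0 i, i, mu0 i - 1) :: 'a sym)) =
      rho (ev (n, j, t - 1)) * (\<Prod>i\<in>{j + 1..n}. rho (ev (?p0 i, i, mu0 i - 1)))"
    unfolding I0 split by (subst prod.insert) (auto simp: slice_cycle_def mu0_def)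
  also have "(\<Prod>i\<in>{j + 1..n}. rho (ev (?p0 i, i, mu0 i - 1) :: 'a sym)) = 1"
  proof (rule prod.neutral, rule ballI)
    fix i assume "i \<in> {j + 1..n}"
    then have i: "j < i" "i \<le> n" by auto
    have "1 \<le> i - 1" "i - 1 < n" using i j by auto
    then show "rho (ev (?p0 i, i, mu0 i - 1) :: 'a sym) = 1"
      using rho_ev[of "i - 1" i "lam i - 1"] i j by (simp add: slice_cycle_def mu0_def)
  qed
  also have "rho (ev (n, j, t - 1)) = (PVar (slice_coord r) :: 'a sym)"
  proof -
    have "lam j \<le> lam n" using sorted j by auto
    then have "(n, j, t - 1) \<in> gbasis n lam" using j t by (auto simp: gbasis_iff)
    then show ?thesis
      by (simp add: evar_def rho_PVar slice_val_def slice_coord_def t_def j_def d_def)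
  qed
  finally have "rho (xgen n lam r) = of_int (sign ?p0) * (PVar (slice_coord r) :: 'a sym)" by simp
  moreover have "sign ?p0 \<in> {1, -1}" by (simp add: sign_def)
  ultimately show ?thesis by blast
qed

text \<open>These are all basis indices with first entry \<open>n\<close>: \<open>lam n\<close> is
  the largest part, so s_{n,j} = 0.\<close>

definition slice_vars :: "(nat \<times> nat \<times> nat) set" where
  "slice_vars = (\<lambda>(j, t). (n, j, t)) ` (SIGMA j:{1..n}. {..<lam j})"

text \<open>Both sets have N elements, so inclusion and injectivity suffice.\<close>

lemma slice_coord_bij: "bij_betw slice_coord {1..totN n lam} slice_vars"
proof -
  have sub: "slice_coord ` {1..totN n lam} \<subseteq> slice_vars"
  proof
    fix c assume "c \<in> slice_coord ` {1..totN n lam}"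
    then obtain r where r: "r \<in> {1..totN n lam}" and c: "c = slice_coord r" by blast
    note d = dseq_bounds[OF r]
    have "topsum (dseq n lam r) = topsum (dseq n lam r - 1) + lam (n - (dseq n lam r - 1))"
      using d(1) by (cases "dseq n lam r") auto
    moreover have "n - (dseq n lam r - 1) = n + 1 - dseq n lam r" using d by simp
    ultimately have "r - topsum (dseq n lam r - 1) - 1 < lam (n + 1 - dseq n lam r)"
      using d by simp
    then show "c \<in> slice_vars" using d by (auto simp: c slice_coord_def slice_vars_def image_iff)
  qed
  have inj: "inj_on slice_coord {1..totN n lam}"
  proof (rule inj_onI)
    fix r r' assume r: "r \<in> {1..totN n lam}" and r': "r' \<in> {1..totN n lam}" and e: "slice_coord r = slice_coord r'"
    note d = dseq_bounds[OF r] note d' = dseq_bounds[OF r']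
    \<comment> \<open>The column determines d because d is at most \<open>n\<close>; then
      \<open>r\<close> is recovered because it exceeds \<open>topsum (d - 1)\<close>.\<close>
    have dd: "dseq n lam r = dseq n lam r'"
    proof -
      have "n + 1 - dseq n lam r = n + 1 - dseq n lam r'" using e by (simp add: slice_coord_def)
      then show ?thesis using d(2) d'(2) by linarith
    qed
    have "r - topsum (dseq n lam r - 1) - 1 = r' - topsum (dseq n lam r - 1) - 1"
      using e by (simp add: slice_coord_def dd)
    then show "r = r'" using d(3) d'(3)[folded dd] by linarith
  qed
  have fin: "finite slice_vars" unfolding slice_vars_def by auto
  have "card slice_vars = card (SIGMA j:{1..n}. {..<lam j})"
    unfolding slice_vars_def by (rule card_image) (auto simp: inj_on_def)
  also have "\<dots> = card (slice_coord ` {1..totN n lam})"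
    using inj by (simp add: card_image totN_def)
  finally have "slice_coord ` {1..totN n lam} = slice_vars"
    by (intro card_subset_eq[OF fin sub]) simp
  then show ?thesis using inj by (simp add: bij_betw_def)
qed

lemma in_vars_rho:
  fixes p :: "'a::field sym"
  assumes "p \<in> Sge n lam"
  shows "in_vars slice_vars (rho p)"
  unfolding rho_def
proof (rule in_vars_mev[OF _ _ assms[unfolded Sge_iff]])
  show "in_vars slice_vars (PConst x :: 'a sym)" for x by (simp add: PConst_def in_vars_const)
  fix c assume c: "c \<in> gbasis n lam"
  obtain i j t where e: "c = (i, j, t)" by (metis prod_cases3)
  have "(i, j, t) \<in> slice_vars" if "\<not> i < n"
    using c that by (auto simp: e gbasis_iff slice_vars_def image_iff)
  then show "in_vars slice_vars (slice_val c :: 'a sym)"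
    by (auto simp: e slice_val_def PVar_def in_vars_0 in_vars_1 intro: in_vars_var)
qed

text \<open>Substitution of the generators followed by restriction sends the variables to the slice
  coordinates up to sign, hence is invertible. The left inverse gives independence; the right
  inverse together with \<open>rho_inj_InvS\<close> gives generation.\<close>

lemma generators_free_and_complete:
  shows "(\<forall>Q :: (nat \<Rightarrow>\<^sub>0 nat) \<Rightarrow>\<^sub>0 'a::field_char_0. in_vars {1..totN n lam} Q \<and> peval Q (xgen n lam) = 0 \<longrightarrow> Q = 0)
    \<and> (\<forall>p\<in>InvS n lam. \<exists>Q :: (nat \<Rightarrow>\<^sub>0 nat) \<Rightarrow>\<^sub>0 'a. in_vars {1..totN n lam} Q \<and> p = peval Q (xgen n lam))"
proof -
  let ?N = "{1..totN n lam}"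
  let ?X = "\<lambda>r. Poly_Mapping.single (Poly_Mapping.single r 1) 1 :: (nat \<Rightarrow>\<^sub>0 nat) \<Rightarrow>\<^sub>0 'a"
  obtain sg where sg: "\<And>r. r \<in> ?N \<Longrightarrow> sg r \<in> {1, - 1 :: int} \<and>
      rho (xgen n lam r) = of_int (sg r) * (PVar (slice_coord r) :: 'a sym)"
    using bchoice[of ?N "\<lambda>r s. s \<in> {1, - 1 :: int} \<and>
      rho (xgen n lam r) = of_int s * (PVar (slice_coord r) :: 'a sym)"] rho_xgen by blast
  have sgsg: "of_int (sg r) * (of_int (sg r) * x) = x" if "r \<in> ?N" for r and x :: "'b::ring_1"
    using sg[OF that] by auto
  define w where "w = inv_into ?N slice_coord"
  have w: "w (slice_coord r) = r" if "r \<in> ?N" for r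
    using slice_coord_bij that by (simp add: w_def bij_betw_inv_into_left)
  have w': "w c \<in> ?N" "slice_coord (w c) = c" if "c \<in> slice_vars" for c
    using slice_coord_bij that inv_into_into[of c slice_coord ?N]
    by (simp_all add: w_def bij_betw_inv_into_right bij_betw_imp_surj_on)
  \<comment> \<open>The inverse of substitution followed by restriction; the sign is repeated
    because it is its own inverse.\<close>
  define kap where "kap = mev (Poly_Mapping.single 0) (\<lambda>c. of_int (sg (w c)) * ?X (w c))"
  have kap: "ring_morph kap" unfolding kap_def by (intro mev_morph ring_morph_single0)
  have kap_var: "kap (PVar c) = of_int (sg (w c)) * ?X (w c)" for c
    by (simp add: kap_def ring_morph_single0)
  have kap_const: "kap (PConst c) = Poly_Mapping.single 0 c" for c
    by (simp add: kap_def ring_morph_single0)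
  define ex where "ex Q = peval Q (xgen n lam)" for Q :: "(nat \<Rightarrow>\<^sub>0 nat) \<Rightarrow>\<^sub>0 'a"
  have ex_eq: "ex = mev PConst (xgen n lam)" by (simp add: ex_def[abs_def] peval_mev)
  have ex: "ring_morph ex" unfolding ex_eq by (intro mev_morph PConst_morph)
  have ex_var: "ex (?X r) = xgen n lam r" for r unfolding ex_eq
    using mev_var[OF PConst_morph, of "xgen n lam" r] by simp
  have ex_const: "ex (Poly_Mapping.single 0 c) = PConst c" for c
    by (simp add: ex_eq mev_const PConst_morph)
  have inv1: "kap (rho (ex Q)) = Q" if "in_vars ?N Q" for Q
  proof (rule ring_morph_eqI[OF _ ring_morph_id, where B = ?N])
    show "ring_morph (\<lambda>Q. kap (rho (ex Q)))"
      by (intro ring_morph_comp[OF kap] ring_morph_comp[OF rho_morph] ex)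
    show "kap (rho (ex (Poly_Mapping.single 0 c))) = Poly_Mapping.single 0 c" for c
      by (simp add: ex_const kap_const)
    show "kap (rho (ex (?X r))) = ?X r" if "r \<in> ?N" for r
      unfolding ex_var using sg[OF that] sgsg[OF that]
      by (simp only: ring_morph_mult[OF kap] ring_morph_of_int[OF kap] kap_var w[OF that])
  qed (use that in \<open>simp add: in_vars_def\<close>)
  have inv2: "rho (ex (kap p)) = p" if "in_vars slice_vars p" for p
  proof (rule ring_morph_eqI[OF _ ring_morph_id, where B = slice_vars])
    show "ring_morph (\<lambda>p. rho (ex (kap p)))"
      by (intro ring_morph_comp[OF rho_morph] ring_morph_comp[OF ex] kap)
    show "rho (ex (kap (Poly_Mapping.single 0 c))) = Poly_Mapping.single 0 c" for c
      using rho_PConst[of c] ex_const[of c] kap_const[of c] by (simp add: PConst_def)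
    fix c assume c: "c \<in> slice_vars"
    have "rho (ex (kap (PVar c))) = (PVar c :: 'a sym)"
      using sg[OF w'(1)[OF c]] sgsg[OF w'(1)[OF c]] w'(2)[OF c]
      by (simp only: kap_var ring_morph_mult[OF ex] ring_morph_of_int[OF ex] ex_var
          ring_morph_mult[OF rho_morph] ring_morph_of_int[OF rho_morph])
    then show "rho (ex (kap (Poly_Mapping.single (Poly_Mapping.single c 1) 1))) =
        (Poly_Mapping.single (Poly_Mapping.single c 1) 1 :: 'a sym)"
      by (simp add: PVar_def)
  qed (use that in \<open>simp add: in_vars_def\<close>)
  show ?thesis
  proof (intro conjI allI impI ballI)
    fix Q :: "(nat \<Rightarrow>\<^sub>0 nat) \<Rightarrow>\<^sub>0 'a"
    assume Q: "in_vars ?N Q \<and> peval Q (xgen n lam) = 0"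
    then have "ex Q = 0" by (simp add: ex_def)
    then show "Q = 0" using inv1[of Q] Q by (simp add: ring_morph_0[OF kap])
  next
    fix p :: "'a sym" assume p: "p \<in> InvS n lam"
    have pv: "in_vars slice_vars (rho p)" using p by (intro in_vars_rho) (simp add: InvS_def)
    \<comment> \<open>With this \<open>Q\<close>, the invariants \<open>p\<close> and
      \<open>ex Q\<close> have the same restriction, so they coincide.\<close>
    define Q where "Q = kap (rho p)"
    have Q: "in_vars ?N Q" unfolding Q_def kap_def
      by (rule in_vars_mev[OF _ _ pv])
         (use w' in \<open>auto intro!: in_vars_mult in_vars_of_int in_vars_var in_vars_const\<close>)
    have "ex Q \<in> InvS n lam" unfolding ex_def
      by (rule InvS_peval[where A = ?N]) (use Q xgen_InvS in \<open>auto simp: in_vars_def\<close>)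
    then have "p - ex Q \<in> InvS n lam" using p by (intro InvS_diff)
    moreover have "rho (p - ex Q) = 0" using inv2[OF pv] by (simp add: Q_def)
    ultimately have "p - ex Q = 0" by (rule rho_inj_InvS)
    then have "p = peval Q (xgen n lam)" by (simp add: ex_def)
    then show "\<exists>Q. in_vars ?N Q \<and> p = peval Q (xgen n lam)" using Q by blast
  qed
qed

end

theorem theorem4p1:
  fixes n :: nat and lam :: "nat \<Rightarrow> nat"
  assumes pos: "\<forall>i\<in>{1..n}. 0 < lam i"
    and sorted: "\<forall>i\<in>{1..n}. \<forall>j\<in>{1..n}. i \<le> j \<longrightarrow> lam i \<le> lam j"
  shows "(\<forall>r\<in>{1..totN n lam}. (xgen n lam r :: 'a::{alg_closed_field, field_char_0} sym) \<in> InvS n lam)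
    \<and> (\<forall>Q :: (nat \<Rightarrow>\<^sub>0 nat) \<Rightarrow>\<^sub>0 'a.
          (\<forall>m\<in>Poly_Mapping.keys Q. Poly_Mapping.keys m \<subseteq> {1..totN n lam})
          \<and> peval Q (xgen n lam) = 0 \<longrightarrow> Q = 0)
    \<and> (\<forall>p\<in>InvS n lam. \<exists>Q :: (nat \<Rightarrow>\<^sub>0 nat) \<Rightarrow>\<^sub>0 'a.
          (\<forall>m\<in>Poly_Mapping.keys Q. Poly_Mapping.keys m \<subseteq> {1..totN n lam})
          \<and> p = peval Q (xgen n lam))"
proof -
  interpret sorted_composition n lam by unfold_locales (fact pos, fact sorted)
  show ?thesis
    using xgen_InvS generators_free_and_complete unfolding in_vars_def by blast
qed

end
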